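(* Let $\mathbb{K}$ be a field. Any $2$-Engel $\mathbb{K}$-Lie algebra is an intrinsic Schreier special object with respect to every natural imaginary splitting in the category $\mathsf{Lie}_{\mathbb{K}}$ of $\mathbb{K}$-Lie algebras.
   Context: A $\mathbb{K}$-Lie algebra $\mathfrak{e}$ is $2$-Engel if $[[x,y],y]=0$ for all $x,y\in\mathfrak{e}$. In $\mathsf{Lie}_{\mathbb{K}}$ imaginary morphisms are taken with respect to the free algebra comonad, so an imaginary morphism $\mathfrak{x}\dashrightarrow\mathfrak{y}$ between Lie algebras is just a function between the underlying sets (equivalently, a Lie algebra morphism from the free Lie algebra on the set $\mathfrak{x}$ to $\mathfrak{y}$), and composition of imaginary morphisms is composition of functions. A natural imaginary splitting in $\mathsf{Lie}_{\mathbb{K}}$ is a family of functions $t_{\mathfrak{x},\mathfrak{y}}\colon\mathfrak{x}\times\mathfrak{y}\to\mathfrak{x}+\mathfrak{y}$ (with $+$ the coproduct in $\mathsf{Lie}_{\mathbb{K}}$), for all $\mathbb{K}$-Lie algebras $\mathfrak{x},\mathfrak{y}$, which is natural, i.e. $(f+g)\,t_{\mathfrak{x},\mathfrak{y}}=t_{\mathfrak{x}',\mathfrak{y}'}\,(f\times g)$ for all Lie algebra morphisms $f\colon\mathfrak{x}\to\mathfrak{x}'$, $g\colon\mathfrak{y}\to\mathfrak{y}'$, and which satisfies $r_{\mathfrak{x},\mathfrak{y}}(t_{\mathfrak{x},\mathfrak{y}}(x,y))=(x,y)$ for all $x\in\mathfrak{x}$, $y\in\mathfrak{y}$, where $r_{\mathfrak{x},\mathfrak{y}}\colon\mathfrak{x}+\mathfrak{y}\to\mathfrak{x}\times\mathfrak{y}$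 is the canonical morphism. It induces on each Lie algebra $\mathfrak{x}$ an imaginary addition, the function $\mu^{\mathfrak{x}}=\nabla_{\mathfrak{x}}t_{\mathfrak{x},\mathfrak{x}}\colon\mathfrak{x}\times\mathfrak{x}\to\mathfrak{x}$, where $\nabla_{\mathfrak{x}}\colon\mathfrak{x}+\mathfrak{x}\to\mathfrak{x}$ is the codiagonal. A split epimorphism of Lie algebras $f\colon X\to Y$ with chosen section $s$ and kernel $k\colon K\to X$ is intrinsic Schreier with respect to $t$ if there is a function $q\colon X\to K$ with $\mu^X(kq(x),sf(x))=x$ for all $x\in X$ and $q(\mu^X(k(a),s(y)))=a$ for all $a\in K$, $y\in Y$. An object $Y$ is an intrinsic Schreier special object with respect to $t$ if the split epimorphism $\pi_2\colon Y\times Y\to Y$ (second projection) with section $\langle 1_Y,1_Y\rangle$ (diagonal) and kernel $\langle 1_Y,0\rangle\colon Y\to Y\times Y$ is intrinsic Schreier with respect to $t$. *)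

theory Defs
  imports "HOL-Algebra.Module"
begin

section \<open>Lie algebras over a field\<close>

text \<open>
  The fields \<open>mult\<close> and \<open>one\<close> inherited from \<^type>\<open>module\<close> play no role; the Lie bracket is the
  additional field.
\<close>

record ('k, 'a) lie_alg = "('k, 'a) module" +
  bracket :: "'a \<Rightarrow> 'a \<Rightarrow> 'a"

locale lie_algebra = field K + module K L
  for K :: "('k, 'm) ring_scheme" and L :: "('k, 'a) lie_alg" +
  assumes bracket_closed:
      "\<lbrakk>x \<in> carrier L; y \<in> carrier L\<rbrakk> \<Longrightarrow> bracket L x y \<in> carrier L"
    and bracket_add_left:
      "\<lbrakk>x \<in> carrier L; y \<in> carrier L; z \<in> carrier L\<rbrakk>
       \<Longrightarrow> bracket L (x \<oplus>\<^bsub>L\<^esub> y) z = bracket L x z \<oplus>\<^bsub>L\<^esub> bracket L y z"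
    and bracket_add_right:
      "\<lbrakk>x \<in> carrier L; y \<in> carrier L; z \<in> carrier L\<rbrakk>
       \<Longrightarrow> bracket L x (y \<oplus>\<^bsub>L\<^esub> z) = bracket L x y \<oplus>\<^bsub>L\<^esub> bracket L x z"
    and bracket_smult_left:
      "\<lbrakk>a \<in> carrier K; x \<in> carrier L; y \<in> carrier L\<rbrakk>
       \<Longrightarrow> bracket L (a \<odot>\<^bsub>L\<^esub> x) y = a \<odot>\<^bsub>L\<^esub> bracket L x y"
    and bracket_smult_right:
      "\<lbrakk>a \<in> carrier K; x \<in> carrier L; y \<in> carrier L\<rbrakk>
       \<Longrightarrow> bracket L x (a \<odot>\<^bsub>L\<^esub> y) = a \<odot>\<^bsub>L\<^esub> bracket L x y"
    and bracket_alternating: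
      "x \<in> carrier L \<Longrightarrow> bracket L x x = \<zero>\<^bsub>L\<^esub>"
    and jacobi:
      "\<lbrakk>x \<in> carrier L; y \<in> carrier L; z \<in> carrier L\<rbrakk>
       \<Longrightarrow> bracket L x (bracket L y z) \<oplus>\<^bsub>L\<^esub> (bracket L y (bracket L z x)
             \<oplus>\<^bsub>L\<^esub> bracket L z (bracket L x y)) = \<zero>\<^bsub>L\<^esub>"

definition two_engel :: "('k, 'a) lie_alg \<Rightarrow> bool" where
  "two_engel L \<longleftrightarrow>
     (\<forall>x\<in>carrier L. \<forall>y\<in>carrier L. bracket L (bracket L x y) y = \<zero>\<^bsub>L\<^esub>)"

definition lie_hom ::
    "('k, 'm) ring_scheme \<Rightarrow> ('k, 'a) lie_alg \<Rightarrow> ('k, 'b) lie_alg \<Rightarrow> ('a \<Rightarrow> 'b) set" where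
  "lie_hom K L M =
     {f. f \<in> carrier L \<rightarrow> carrier M \<and>
         (\<forall>x\<in>carrier L. \<forall>y\<in>carrier L. f (x \<oplus>\<^bsub>L\<^esub> y) = f x \<oplus>\<^bsub>M\<^esub> f y) \<and>
         (\<forall>a\<in>carrier K. \<forall>x\<in>carrier L. f (a \<odot>\<^bsub>L\<^esub> x) = a \<odot>\<^bsub>M\<^esub> f x) \<and>
         (\<forall>x\<in>carrier L. \<forall>y\<in>carrier L. f (bracket L x y) = bracket M (f x) (f y))}"

definition lie_iso ::
    "('k, 'm) ring_scheme \<Rightarrow> ('k, 'a) lie_alg \<Rightarrow> ('k, 'b) lie_alg \<Rightarrow> ('a \<Rightarrow> 'b) set" where
  "lie_iso K L M = {f \<in> lie_hom K L M. bij_betw f (carrier L) (carrier M)}"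

definition lie_prod ::
    "('k, 'a) lie_alg \<Rightarrow> ('k, 'b) lie_alg \<Rightarrow> ('k, 'a \<times> 'b) lie_alg" where
  "lie_prod L M =
     \<lparr>carrier = carrier L \<times> carrier M,
      mult = undefined, one = undefined,
      zero = (\<zero>\<^bsub>L\<^esub>, \<zero>\<^bsub>M\<^esub>),
      add = (\<lambda>(x, y) (x', y'). (x \<oplus>\<^bsub>L\<^esub> x', y \<oplus>\<^bsub>M\<^esub> y')),
      smult = (\<lambda>a (x, y). (a \<odot>\<^bsub>L\<^esub> x, a \<odot>\<^bsub>M\<^esub> y)),
      bracket = (\<lambda>(x, y) (x', y'). (bracket L x x', bracket M y y'))\<rparr>"

proposition lie_prod_lie_algebra:
  assumes "lie_algebra K L" "lie_algebra K M"
  shows "lie_algebra K (lie_prod L M)"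
proof -
  interpret L: lie_algebra K L by fact
  interpret M: lie_algebra K M by fact
  have cr: "cring K"
    using assms(1) lie_algebra.axioms(2) module.axioms(1) by blast
  have ag: "abelian_group (lie_prod L M)"
  proof (rule abelian_groupI)
    fix x assume "x \<in> carrier (lie_prod L M)"
    then show "\<exists>y\<in>carrier (lie_prod L M). y \<oplus>\<^bsub>lie_prod L M\<^esub> x = \<zero>\<^bsub>lie_prod L M\<^esub>"
      by (intro bexI[where x = "(\<ominus>\<^bsub>L\<^esub> fst x, \<ominus>\<^bsub>M\<^esub> snd x)"])
        (auto simp: lie_prod_def L.M.l_neg M.M.l_neg)
  qed (auto simp: lie_prod_def L.M.a_assoc M.M.a_assoc intro: L.M.a_comm M.M.a_comm)
  have md: "module K (lie_prod L M)"
    by (rule moduleI[OF cr ag])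
      (auto simp: lie_prod_def L.smult_l_distr M.smult_l_distr L.smult_r_distr M.smult_r_distr
        L.smult_assoc1 M.smult_assoc1)
  have ax: "lie_algebra_axioms K (lie_prod L M)"
    by (rule lie_algebra_axioms.intro)
      (auto simp: lie_prod_def L.bracket_closed M.bracket_closed L.bracket_add_left
        M.bracket_add_left L.bracket_add_right M.bracket_add_right L.bracket_smult_left
        M.bracket_smult_left L.bracket_smult_right M.bracket_smult_right
        L.bracket_alternating M.bracket_alternating L.jacobi M.jacobi)
  show ?thesis
    by (rule lie_algebra.intro[OF L.field_axioms md ax])
qed


section \<open>Coproducts\<close>

text \<open>
  The coproduct of \<open>L\<close> and \<open>M\<close> is built from formal Lie expressions in the elements of \<open>L\<close> and \<open>M\<close>,
  modulo the congruence generated by the Lie algebra axioms and by the requirement that both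
  insertions be morphisms.
\<close>

datatype ('k, 'a, 'b) lie_term =
    InL 'a
  | InR 'b
  | Zero
  | Add "('k, 'a, 'b) lie_term" "('k, 'a, 'b) lie_term"
  | Smult 'k "('k, 'a, 'b) lie_term"
  | Bracket "('k, 'a, 'b) lie_term" "('k, 'a, 'b) lie_term"

inductive_set lie_terms ::
    "('k, 'm) ring_scheme \<Rightarrow> ('k, 'a) lie_alg \<Rightarrow> ('k, 'b) lie_alg \<Rightarrow> ('k, 'a, 'b) lie_term set"
  for K L M where
    InL: "x \<in> carrier L \<Longrightarrow> InL x \<in> lie_terms K L M"
  | InR: "y \<in> carrier M \<Longrightarrow> InR y \<in> lie_terms K L M"
  | Zero: "Zero \<in> lie_terms K L M"
  | Add: "\<lbrakk>u \<in> lie_terms K L M; v \<in> lie_terms K L M\<rbrakk> \<Longrightarrow> Add u v \<in> lie_terms K L M"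
  | Smult: "\<lbrakk>a \<in> carrier K; u \<in> lie_terms K L M\<rbrakk> \<Longrightarrow> Smult a u \<in> lie_terms K L M"
  | Bracket: "\<lbrakk>u \<in> lie_terms K L M; v \<in> lie_terms K L M\<rbrakk> \<Longrightarrow> Bracket u v \<in> lie_terms K L M"

inductive coprod_eq ::
    "('k, 'm) ring_scheme \<Rightarrow> ('k, 'a) lie_alg \<Rightarrow> ('k, 'b) lie_alg
     \<Rightarrow> ('k, 'a, 'b) lie_term \<Rightarrow> ('k, 'a, 'b) lie_term \<Rightarrow> bool"
  for K L M where
    refl: "u \<in> lie_terms K L M \<Longrightarrow> coprod_eq K L M u u"
  | sym: "coprod_eq K L M u v \<Longrightarrow> coprod_eq K L M v u"
  | trans: "\<lbrakk>coprod_eq K L M u v; coprod_eq K L M v w\<rbrakk> \<Longrightarrow> coprod_eq K L M u w"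
  | add_cong: "\<lbrakk>coprod_eq K L M u u'; coprod_eq K L M v v'\<rbrakk>
      \<Longrightarrow> coprod_eq K L M (Add u v) (Add u' v')"
  | smult_cong: "\<lbrakk>a \<in> carrier K; coprod_eq K L M u u'\<rbrakk>
      \<Longrightarrow> coprod_eq K L M (Smult a u) (Smult a u')"
  | bracket_cong: "\<lbrakk>coprod_eq K L M u u'; coprod_eq K L M v v'\<rbrakk>
      \<Longrightarrow> coprod_eq K L M (Bracket u v) (Bracket u' v')"
  | add_assoc: "\<lbrakk>u \<in> lie_terms K L M; v \<in> lie_terms K L M; w \<in> lie_terms K L M\<rbrakk>
      \<Longrightarrow> coprod_eq K L M (Add (Add u v) w) (Add u (Add v w))"
  | add_comm: "\<lbrakk>u \<in> lie_terms K L M; v \<in> lie_terms K L M\<rbrakk>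
      \<Longrightarrow> coprod_eq K L M (Add u v) (Add v u)"
  | add_zero: "u \<in> lie_terms K L M \<Longrightarrow> coprod_eq K L M (Add Zero u) u"
  | add_neg: "u \<in> lie_terms K L M
      \<Longrightarrow> coprod_eq K L M (Add (Smult (\<ominus>\<^bsub>K\<^esub> \<one>\<^bsub>K\<^esub>) u) u) Zero"
  | smult_add_left: "\<lbrakk>a \<in> carrier K; b \<in> carrier K; u \<in> lie_terms K L M\<rbrakk>
      \<Longrightarrow> coprod_eq K L M (Smult (a \<oplus>\<^bsub>K\<^esub> b) u) (Add (Smult a u) (Smult b u))"
  | smult_add_right: "\<lbrakk>a \<in> carrier K; u \<in> lie_terms K L M; v \<in> lie_terms K L M\<rbrakk>
      \<Longrightarrow> coprod_eq K L M (Smult a (Add u v)) (Add (Smult a u) (Smult a v))"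
  | smult_assoc: "\<lbrakk>a \<in> carrier K; b \<in> carrier K; u \<in> lie_terms K L M\<rbrakk>
      \<Longrightarrow> coprod_eq K L M (Smult (a \<otimes>\<^bsub>K\<^esub> b) u) (Smult a (Smult b u))"
  | smult_one: "u \<in> lie_terms K L M \<Longrightarrow> coprod_eq K L M (Smult \<one>\<^bsub>K\<^esub> u) u"
  | bracket_add_left: "\<lbrakk>u \<in> lie_terms K L M; v \<in> lie_terms K L M; w \<in> lie_terms K L M\<rbrakk>
      \<Longrightarrow> coprod_eq K L M (Bracket (Add u v) w) (Add (Bracket u w) (Bracket v w))"
  | bracket_add_right: "\<lbrakk>u \<in> lie_terms K L M; v \<in> lie_terms K L M; w \<in> lie_terms K L M\<rbrakk>
      \<Longrightarrow> coprod_eq K L M (Bracket u (Add v w)) (Add (Bracket u v) (Bracket u w))"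
  | bracket_smult_left: "\<lbrakk>a \<in> carrier K; u \<in> lie_terms K L M; v \<in> lie_terms K L M\<rbrakk>
      \<Longrightarrow> coprod_eq K L M (Bracket (Smult a u) v) (Smult a (Bracket u v))"
  | bracket_smult_right: "\<lbrakk>a \<in> carrier K; u \<in> lie_terms K L M; v \<in> lie_terms K L M\<rbrakk>
      \<Longrightarrow> coprod_eq K L M (Bracket u (Smult a v)) (Smult a (Bracket u v))"
  | bracket_alternating: "u \<in> lie_terms K L M \<Longrightarrow> coprod_eq K L M (Bracket u u) Zero"
  | jacobi: "\<lbrakk>u \<in> lie_terms K L M; v \<in> lie_terms K L M; w \<in> lie_terms K L M\<rbrakk>
      \<Longrightarrow> coprod_eq K L M
            (Add (Bracket u (Bracket v w)) (Add (Bracket v (Bracket w u)) (Bracket w (Bracket u v))))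
            Zero"
  | InL_add: "\<lbrakk>x \<in> carrier L; x' \<in> carrier L\<rbrakk>
      \<Longrightarrow> coprod_eq K L M (InL (x \<oplus>\<^bsub>L\<^esub> x')) (Add (InL x) (InL x'))"
  | InL_smult: "\<lbrakk>a \<in> carrier K; x \<in> carrier L\<rbrakk>
      \<Longrightarrow> coprod_eq K L M (InL (a \<odot>\<^bsub>L\<^esub> x)) (Smult a (InL x))"
  | InL_bracket: "\<lbrakk>x \<in> carrier L; x' \<in> carrier L\<rbrakk>
      \<Longrightarrow> coprod_eq K L M (InL (bracket L x x')) (Bracket (InL x) (InL x'))"
  | InR_add: "\<lbrakk>y \<in> carrier M; y' \<in> carrier M\<rbrakk>
      \<Longrightarrow> coprod_eq K L M (InR (y \<oplus>\<^bsub>M\<^esub> y')) (Add (InR y) (InR y'))"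
  | InR_smult: "\<lbrakk>a \<in> carrier K; y \<in> carrier M\<rbrakk>
      \<Longrightarrow> coprod_eq K L M (InR (a \<odot>\<^bsub>M\<^esub> y)) (Smult a (InR y))"
  | InR_bracket: "\<lbrakk>y \<in> carrier M; y' \<in> carrier M\<rbrakk>
      \<Longrightarrow> coprod_eq K L M (InR (bracket M y y')) (Bracket (InR y) (InR y'))"

definition coprod_class ::
    "('k, 'm) ring_scheme \<Rightarrow> ('k, 'a) lie_alg \<Rightarrow> ('k, 'b) lie_alg
     \<Rightarrow> ('k, 'a, 'b) lie_term \<Rightarrow> ('k, 'a, 'b) lie_term set" where
  "coprod_class K L M u = {v. coprod_eq K L M u v}"

definition lie_coprod ::
    "('k, 'm) ring_scheme \<Rightarrow> ('k, 'a) lie_alg \<Rightarrow> ('k, 'b) lie_alg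
     \<Rightarrow> ('k, ('k, 'a, 'b) lie_term set) lie_alg" where
  "lie_coprod K L M =
     \<lparr>carrier = coprod_class K L M ` lie_terms K L M,
      mult = undefined, one = undefined,
      zero = coprod_class K L M Zero,
      add = (\<lambda>A B. \<Union>u\<in>A. \<Union>v\<in>B. coprod_class K L M (Add u v)),
      smult = (\<lambda>a A. \<Union>u\<in>A. coprod_class K L M (Smult a u)),
      bracket = (\<lambda>A B. \<Union>u\<in>A. \<Union>v\<in>B. coprod_class K L M (Bracket u v))\<rparr>"

definition coprod_inl ::
    "('k, 'm) ring_scheme \<Rightarrow> ('k, 'a) lie_alg \<Rightarrow> ('k, 'b) lie_alg
     \<Rightarrow> 'a \<Rightarrow> ('k, 'a, 'b) lie_term set" where
  "coprod_inl K L M x = coprod_class K L M (InL x)"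

definition coprod_inr ::
    "('k, 'm) ring_scheme \<Rightarrow> ('k, 'a) lie_alg \<Rightarrow> ('k, 'b) lie_alg
     \<Rightarrow> 'b \<Rightarrow> ('k, 'a, 'b) lie_term set" where
  "coprod_inr K L M y = coprod_class K L M (InR y)"

primrec lie_eval ::
    "('k, 'c) lie_alg \<Rightarrow> ('a \<Rightarrow> 'c) \<Rightarrow> ('b \<Rightarrow> 'c) \<Rightarrow> ('k, 'a, 'b) lie_term \<Rightarrow> 'c" where
    "lie_eval N f g (InL x) = f x"
  | "lie_eval N f g (InR y) = g y"
  | "lie_eval N f g Zero = \<zero>\<^bsub>N\<^esub>"
  | "lie_eval N f g (Add u v) = lie_eval N f g u \<oplus>\<^bsub>N\<^esub> lie_eval N f g v"
  | "lie_eval N f g (Smult a u) = a \<odot>\<^bsub>N\<^esub> lie_eval N f g u"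
  | "lie_eval N f g (Bracket u v) = bracket N (lie_eval N f g u) (lie_eval N f g v)"

text \<open>The morphism out of the coproduct into \<open>N\<close> with components \<open>f\<close> and \<open>g\<close>.\<close>

definition copair ::
    "('k, 'c) lie_alg \<Rightarrow> ('a \<Rightarrow> 'c) \<Rightarrow> ('b \<Rightarrow> 'c) \<Rightarrow> ('k, 'a, 'b) lie_term set \<Rightarrow> 'c" where
  "copair N f g A = the_elem (lie_eval N f g ` A)"

lemma coprod_class_eqI:
  assumes "coprod_eq K L M u v"
  shows "coprod_class K L M u = coprod_class K L M v"
proof (intro Set.set_eqI iffI)
  fix w assume "w \<in> coprod_class K L M u"
  then show "w \<in> coprod_class K L M v"
    using assms unfolding coprod_class_def by (auto intro: coprod_eq.trans[OF coprod_eq.sym])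
next
  fix w assume "w \<in> coprod_class K L M v"
  then show "w \<in> coprod_class K L M u"
    using assms unfolding coprod_class_def by (auto intro: coprod_eq.trans)
qed

lemma coprod_class_self: "u \<in> lie_terms K L M \<Longrightarrow> u \<in> coprod_class K L M u"
  by (simp add: coprod_class_def coprod_eq.refl)

lemma lie_coprod_add:
  assumes "u \<in> lie_terms K L M" "v \<in> lie_terms K L M"
  shows "coprod_class K L M u \<oplus>\<^bsub>lie_coprod K L M\<^esub> coprod_class K L M v
           = coprod_class K L M (Add u v)"
proof -
  have "coprod_class K L M (Add u' v') = coprod_class K L M (Add u v)"
    if "u' \<in> coprod_class K L M u" "v' \<in> coprod_class K L M v" for u' v'
    using that unfolding coprod_class_def[of K L M u] coprod_class_def[of K L M v]
    by (auto del: equalityI intro!: coprod_class_eqI coprod_eq.add_cong intro: coprod_eq.sym)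
  then show ?thesis
    unfolding lie_coprod_def lie_alg.simps module.simps ring.simps
    by (intro UN_constant_eq[OF coprod_class_self] ballI assms) simp
qed

lemma lie_coprod_smult:
  assumes "a \<in> carrier K" "u \<in> lie_terms K L M"
  shows "a \<odot>\<^bsub>lie_coprod K L M\<^esub> coprod_class K L M u = coprod_class K L M (Smult a u)"
proof -
  have "coprod_class K L M (Smult a u') = coprod_class K L M (Smult a u)"
    if "u' \<in> coprod_class K L M u" for u'
    using that assms(1) unfolding coprod_class_def[of K L M u]
    by (auto del: equalityI intro!: coprod_class_eqI coprod_eq.smult_cong intro: coprod_eq.sym)
  then show ?thesis
    unfolding lie_coprod_def lie_alg.simps module.simps ring.simps
    by (intro UN_constant_eq[OF coprod_class_self] ballI assms) simp
qed

lemma lie_coprod_bracket: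
  assumes "u \<in> lie_terms K L M" "v \<in> lie_terms K L M"
  shows "bracket (lie_coprod K L M) (coprod_class K L M u) (coprod_class K L M v)
           = coprod_class K L M (Bracket u v)"
proof -
  have "coprod_class K L M (Bracket u' v') = coprod_class K L M (Bracket u v)"
    if "u' \<in> coprod_class K L M u" "v' \<in> coprod_class K L M v" for u' v'
    using that unfolding coprod_class_def[of K L M u] coprod_class_def[of K L M v]
    by (auto del: equalityI intro!: coprod_class_eqI coprod_eq.bracket_cong intro: coprod_eq.sym)
  then show ?thesis
    unfolding lie_coprod_def lie_alg.simps module.simps ring.simps
    by (intro UN_constant_eq[OF coprod_class_self] ballI assms) simp
qed

lemmas lie_coprod_ops = lie_coprod_add lie_coprod_smult lie_coprod_bracket

lemma lie_coprod_carrier: "carrier (lie_coprod K L M) = coprod_class K L M ` lie_terms K L M"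
  and lie_coprod_zero: "\<zero>\<^bsub>lie_coprod K L M\<^esub> = coprod_class K L M Zero"
  by (simp_all add: lie_coprod_def)

proposition lie_coprod_lie_algebra:
  assumes "lie_algebra K L" "lie_algebra K M"
  shows "lie_algebra K (lie_coprod K L M)"
proof -
  interpret L: lie_algebra K L by fact
  note ops = lie_coprod_ops lie_coprod_carrier lie_coprod_zero
  note [intro] = lie_terms.intros
  have cr: "cring K"
    using assms(1) lie_algebra.axioms(2) module.axioms(1) by blast
  have ag: "abelian_group (lie_coprod K L M)"
  proof (rule abelian_groupI)
    fix x assume "x \<in> carrier (lie_coprod K L M)"
    then obtain u where u: "u \<in> lie_terms K L M" "x = coprod_class K L M u"
      by (auto simp: ops)
    have m: "\<ominus>\<^bsub>K\<^esub> \<one>\<^bsub>K\<^esub> \<in> carrier K" by simp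
    have "coprod_class K L M (Smult (\<ominus>\<^bsub>K\<^esub> \<one>\<^bsub>K\<^esub>) u) \<oplus>\<^bsub>lie_coprod K L M\<^esub> x = \<zero>\<^bsub>lie_coprod K L M\<^esub>"
      using u m by (auto simp: ops lie_terms.intros del: equalityI intro!: coprod_class_eqI coprod_eq.add_neg)
    moreover have "coprod_class K L M (Smult (\<ominus>\<^bsub>K\<^esub> \<one>\<^bsub>K\<^esub>) u) \<in> carrier (lie_coprod K L M)"
      using u m by (auto simp: ops)
    ultimately show "\<exists>y\<in>carrier (lie_coprod K L M). y \<oplus>\<^bsub>lie_coprod K L M\<^esub> x = \<zero>\<^bsub>lie_coprod K L M\<^esub>"
      by blast
  qed (auto simp: ops lie_terms.intros
        del: equalityI intro!: coprod_class_eqI coprod_eq.add_assoc coprod_eq.add_comm coprod_eq.add_zero)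
  have md: "module K (lie_coprod K L M)"
    by (rule moduleI[OF cr ag])
      (auto simp: ops lie_terms.intros del: equalityI intro!: coprod_class_eqI coprod_eq.smult_add_left
        coprod_eq.smult_add_right coprod_eq.smult_assoc coprod_eq.smult_one)
  have ax: "lie_algebra_axioms K (lie_coprod K L M)"
    by (rule lie_algebra_axioms.intro)
      (auto simp: ops lie_terms.intros del: equalityI intro!: coprod_class_eqI coprod_eq.bracket_add_left
        coprod_eq.bracket_add_right coprod_eq.bracket_smult_left coprod_eq.bracket_smult_right
        coprod_eq.bracket_alternating coprod_eq.jacobi)
  show ?thesis
    by (rule lie_algebra.intro[OF L.field_axioms md ax])
qed

proposition coprod_inl_hom:
  assumes "lie_algebra K L" "lie_algebra K M"
  shows "coprod_inl K L M \<in> lie_hom K L (lie_coprod K L M)"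
proof -
  interpret L: lie_algebra K L by fact
  show ?thesis
    by (auto simp: lie_hom_def coprod_inl_def lie_coprod_ops lie_coprod_carrier
        lie_terms.intros L.bracket_closed
        del: equalityI intro!: coprod_class_eqI coprod_eq.InL_add coprod_eq.InL_smult coprod_eq.InL_bracket)
qed

proposition coprod_inr_hom:
  assumes "lie_algebra K L" "lie_algebra K M"
  shows "coprod_inr K L M \<in> lie_hom K M (lie_coprod K L M)"
proof -
  interpret M: lie_algebra K M by fact
  show ?thesis
    by (auto simp: lie_hom_def coprod_inr_def lie_coprod_ops lie_coprod_carrier
        lie_terms.intros M.bracket_closed
        del: equalityI intro!: coprod_class_eqI coprod_eq.InR_add coprod_eq.InR_smult coprod_eq.InR_bracket)
qed

lemma lie_eval_closed:
  assumes "lie_algebra K N" "f \<in> lie_hom K L N" "g \<in> lie_hom K M N" "u \<in> lie_terms K L M"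
  shows "lie_eval N f g u \<in> carrier N"
proof -
  interpret N: lie_algebra K N by fact
  show ?thesis
    using assms(4) by induction (use assms(2,3) in \<open>auto simp: lie_hom_def N.bracket_closed\<close>)
qed

lemma lie_eval_cong:
  assumes L: "lie_algebra K L" and M: "lie_algebra K M" and N: "lie_algebra K N"
    and f: "f \<in> lie_hom K L N" and g: "g \<in> lie_hom K M N"
    and "coprod_eq K L M u v"
  shows "lie_eval N f g u = lie_eval N f g v"
proof -
  interpret N: lie_algebra K N by fact
  note cl = lie_eval_closed[OF N f g]
  show ?thesis
    using assms(6)
  proof induction
    case (add_neg u)
    have c: "lie_eval N f g u \<in> carrier N" using add_neg cl by blast
    have "\<ominus>\<^bsub>K\<^esub> \<one>\<^bsub>K\<^esub> \<odot>\<^bsub>N\<^esub> lie_eval N f g u = \<ominus>\<^bsub>N\<^esub> lie_eval N f g u"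
      using c N.smult_l_minus[of "\<one>\<^bsub>K\<^esub>"] by simp
    then show ?case using c by (simp add: N.M.l_neg)
  next
    case (add_comm u v)
    then show ?case using cl by (simp add: N.M.a_comm)
  qed (use f g in \<open>auto simp: lie_hom_def cl N.M.a_assoc N.smult_l_distr N.smult_r_distr
        N.smult_assoc1 N.bracket_add_left N.bracket_add_right N.bracket_smult_left
        N.bracket_smult_right N.bracket_alternating N.jacobi\<close>)
qed

lemma copair_class:
  assumes "lie_algebra K L" "lie_algebra K M" "lie_algebra K N"
    and "f \<in> lie_hom K L N" "g \<in> lie_hom K M N" "u \<in> lie_terms K L M"
  shows "copair N f g (coprod_class K L M u) = lie_eval N f g u"
proof -
  have "lie_eval N f g v = lie_eval N f g u" if "v \<in> coprod_class K L M u" for v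
    using that lie_eval_cong[OF assms(1-5)] unfolding coprod_class_def by simp
  then have "lie_eval N f g ` coprod_class K L M u = {lie_eval N f g u}"
    using coprod_class_self[OF assms(6)] by blast
  then show ?thesis by (simp add: copair_def)
qed

text \<open>
  The universal property, with respect to Lie algebras over an arbitrary type; morphisms are
  compared on the carrier only.
\<close>

proposition copair_hom:
  assumes "lie_algebra K L" "lie_algebra K M" "lie_algebra K N"
    and "f \<in> lie_hom K L N" "g \<in> lie_hom K M N"
  shows "copair N f g \<in> lie_hom K (lie_coprod K L M) N"
    and "x \<in> carrier L \<Longrightarrow> copair N f g (coprod_inl K L M x) = f x"
    and "y \<in> carrier M \<Longrightarrow> copair N f g (coprod_inr K L M y) = g y"
  by (auto simp: lie_hom_def[of K "lie_coprod K L M"] coprod_inl_def coprod_inr_def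
      lie_coprod_carrier lie_coprod_ops copair_class[OF assms] lie_terms.intros
      lie_eval_closed[OF assms(3-5)])

proposition copair_unique:
  assumes L: "lie_algebra K L" and M: "lie_algebra K M" and N: "lie_algebra K N"
    and "f \<in> lie_hom K L N" "g \<in> lie_hom K M N"
    and h: "h \<in> lie_hom K (lie_coprod K L M) N"
    and hl: "\<And>x. x \<in> carrier L \<Longrightarrow> h (coprod_inl K L M x) = f x"
    and hr: "\<And>y. y \<in> carrier M \<Longrightarrow> h (coprod_inr K L M y) = g y"
    and c: "c \<in> carrier (lie_coprod K L M)"
  shows "h c = copair N f g c"
proof -
  interpret N: lie_algebra K N by fact
  interpret C: lie_algebra K "lie_coprod K L M" by (rule lie_coprod_lie_algebra[OF L M])
  have h0: "h \<zero>\<^bsub>lie_coprod K L M\<^esub> = \<zero>\<^bsub>N\<^esub>"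
  proof -
    have "h \<zero>\<^bsub>lie_coprod K L M\<^esub> \<in> carrier N"
      using h C.M.zero_closed by (auto simp: lie_hom_def)
    moreover have "h (\<zero>\<^bsub>lie_coprod K L M\<^esub> \<oplus>\<^bsub>lie_coprod K L M\<^esub> \<zero>\<^bsub>lie_coprod K L M\<^esub>)
        = h \<zero>\<^bsub>lie_coprod K L M\<^esub> \<oplus>\<^bsub>N\<^esub> h \<zero>\<^bsub>lie_coprod K L M\<^esub>"
      using h C.M.zero_closed unfolding lie_hom_def by blast
    ultimately show ?thesis using N.M.add.r_cancel_one by fastforce
  qed
  obtain u where u: "u \<in> lie_terms K L M" and c: "c = coprod_class K L M u"
    using c by (auto simp: lie_coprod_carrier)
  have cls: "coprod_class K L M v \<in> carrier (lie_coprod K L M)" if "v \<in> lie_terms K L M" for v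
    using that by (simp add: lie_coprod_carrier)
  have "h (coprod_class K L M u) = lie_eval N f g u"
    using u
  proof induction
    case (InL x) then show ?case using hl by (simp add: coprod_inl_def)
  next
    case (InR y) then show ?case using hr by (simp add: coprod_inr_def)
  next
    case Zero then show ?case using h0 by (simp add: lie_coprod_zero)
  next
    case (Add u v)
    then show ?case
      using h cls by (simp add: lie_coprod_ops(1)[symmetric] lie_hom_def)
  next
    case (Smult a u)
    then show ?case
      using h cls by (simp add: lie_coprod_ops(2)[symmetric] lie_hom_def)
  next
    case (Bracket u v)
    then show ?case
      using h cls by (simp add: lie_coprod_ops(3)[symmetric] lie_hom_def)
  qed
  then show ?thesis
    using u c copair_class[OF assms(1-5)] by simp
qed

text \<open>\<open>f + g\<close>, the codiagonal, and the canonical morphism from the coproduct to the product.\<close>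

definition coprod_map ::
    "('k, 'm) ring_scheme \<Rightarrow> ('k, 'c) lie_alg \<Rightarrow> ('k, 'd) lie_alg \<Rightarrow> ('a \<Rightarrow> 'c) \<Rightarrow> ('b \<Rightarrow> 'd)
     \<Rightarrow> ('k, 'a, 'b) lie_term set \<Rightarrow> ('k, 'c, 'd) lie_term set" where
  "coprod_map K L' M' f g =
     copair (lie_coprod K L' M') (coprod_inl K L' M' \<circ> f) (coprod_inr K L' M' \<circ> g)"

definition codiagonal :: "('k, 'a) lie_alg \<Rightarrow> ('k, 'a, 'a) lie_term set \<Rightarrow> 'a" where
  "codiagonal L = copair L (\<lambda>x. x) (\<lambda>x. x)"

definition coprod_to_prod ::
    "('k, 'a) lie_alg \<Rightarrow> ('k, 'b) lie_alg \<Rightarrow> ('k, 'a, 'b) lie_term set \<Rightarrow> 'a \<times> 'b" where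
  "coprod_to_prod L M = copair (lie_prod L M) (\<lambda>x. (x, \<zero>\<^bsub>M\<^esub>)) (\<lambda>y. (\<zero>\<^bsub>L\<^esub>, y))"


section \<open>Natural imaginary splittings and intrinsic Schreier special objects\<close>

text \<open>
  The objects of the category are the Lie algebras whose carrier is a subset of the type \<open>'u\<close>, which
  thus acts as a universe.  A family indexed by all pairs of objects is a function of two structures
  over \<open>'u\<close>, of which only the values at Lie algebras and at elements of their carriers matter.
\<close>

type_synonym ('k, 'u) splitting =
  "('k, 'u) lie_alg \<Rightarrow> ('k, 'u) lie_alg \<Rightarrow> 'u \<times> 'u \<Rightarrow> ('k, 'u, 'u) lie_term set"

definition natural_imaginary_splitting ::
    "('k, 'm) ring_scheme \<Rightarrow> ('k, 'u) splitting \<Rightarrow> bool" where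
  "natural_imaginary_splitting K t \<longleftrightarrow>
     (\<forall>X Y. lie_algebra K X \<longrightarrow> lie_algebra K Y \<longrightarrow>
        t X Y \<in> carrier X \<times> carrier Y \<rightarrow> carrier (lie_coprod K X Y) \<and>
        (\<forall>x\<in>carrier X. \<forall>y\<in>carrier Y. coprod_to_prod X Y (t X Y (x, y)) = (x, y))) \<and>
     (\<forall>X Y X' Y' f g.
        lie_algebra K X \<longrightarrow> lie_algebra K Y \<longrightarrow> lie_algebra K X' \<longrightarrow> lie_algebra K Y' \<longrightarrow>
        f \<in> lie_hom K X X' \<longrightarrow> g \<in> lie_hom K Y Y' \<longrightarrow>
        (\<forall>x\<in>carrier X. \<forall>y\<in>carrier Y.
           coprod_map K X' Y' f g (t X Y (x, y)) = t X' Y' (f x, g y)))"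

definition imaginary_addition ::
    "('k, 'u) splitting \<Rightarrow> ('k, 'u) lie_alg \<Rightarrow> 'u \<times> 'u \<Rightarrow> 'u" where
  "imaginary_addition t X = codiagonal X \<circ> t X X"

definition is_kernel ::
    "('k, 'm) ring_scheme \<Rightarrow> ('k, 'c) lie_alg \<Rightarrow> ('k, 'a) lie_alg \<Rightarrow> ('k, 'b) lie_alg
     \<Rightarrow> ('c \<Rightarrow> 'a) \<Rightarrow> ('a \<Rightarrow> 'b) \<Rightarrow> bool" where
  "is_kernel K A X Y k f \<longleftrightarrow>
     k \<in> lie_hom K A X \<and> inj_on k (carrier A) \<and>
     k ` carrier A = {x \<in> carrier X. f x = \<zero>\<^bsub>Y\<^esub>}"

text \<open>The split epimorphism is \<open>f : X \<rightarrow> Y\<close> with section \<open>s\<close> and kernel \<open>k : A \<rightarrow> X\<close>.\<close>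

definition intrinsic_schreier ::
    "('k, 'm) ring_scheme \<Rightarrow> ('k, 'u) splitting
     \<Rightarrow> ('k, 'u) lie_alg \<Rightarrow> ('k, 'u) lie_alg \<Rightarrow> ('k, 'u) lie_alg
     \<Rightarrow> ('u \<Rightarrow> 'u) \<Rightarrow> ('u \<Rightarrow> 'u) \<Rightarrow> ('u \<Rightarrow> 'u) \<Rightarrow> bool" where
  "intrinsic_schreier K t X Y A f s k \<longleftrightarrow>
     f \<in> lie_hom K X Y \<and> s \<in> lie_hom K Y X \<and> (\<forall>y\<in>carrier Y. f (s y) = y) \<and>
     is_kernel K A X Y k f \<and>
     (\<exists>q \<in> carrier X \<rightarrow> carrier A.
        (\<forall>x\<in>carrier X. imaginary_addition t X (k (q x), s (f x)) = x) \<and>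
        (\<forall>a\<in>carrier A. \<forall>y\<in>carrier Y. q (imaginary_addition t X (k a, s y)) = a))"

text \<open>
  The cartesian product \<open>Y \<times> Y\<close> lives over \<open>'u \<times> 'u\<close>; inside the universe \<open>'u\<close> it is represented by
  any Lie algebra \<open>P\<close> with an isomorphism \<open>\<phi>\<close> onto it, along which the second projection, the
  diagonal and \<open>\<langle>1, 0\<rangle>\<close> are transported.  Existence of such a \<open>P\<close> is demanded explicitly, so that
  the property is never vacuous.
\<close>

definition intrinsic_schreier_special ::
    "('k, 'm) ring_scheme \<Rightarrow> ('k, 'u) splitting \<Rightarrow> ('k, 'u) lie_alg \<Rightarrow> bool" where
  "intrinsic_schreier_special K t Y \<longleftrightarrow>
     (\<exists>P :: ('k, 'u) lie_alg. lie_algebra K P \<and> lie_iso K P (lie_prod Y Y) \<noteq> {}) \<and>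
     (\<forall>(P :: ('k, 'u) lie_alg) \<phi>.
        lie_algebra K P \<longrightarrow> \<phi> \<in> lie_iso K P (lie_prod Y Y) \<longrightarrow>
        intrinsic_schreier K t P Y Y
          (\<lambda>p. snd (\<phi> p))
          (\<lambda>y. inv_into (carrier P) \<phi> (y, y))
          (\<lambda>y. inv_into (carrier P) \<phi> (y, \<zero>\<^bsub>Y\<^esub>)))"

end

theory Submission
  imports Defs
begin

text \<open>
  A natural imaginary splitting is determined by a single formal Lie expression.  Given a nonzero
  \<open>v\<close> in a Lie algebra \<open>X\<close>, the line \<open>J\<close> spanned by \<open>v\<close> is an abelian Lie algebra, and for every
  \<open>a\<close> in \<open>X\<close> there is a morphism from \<open>J\<close> to \<open>X\<close> sending \<open>v\<close> to \<open>a\<close>.  By naturality, the value of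
  the splitting at \<open>(a, b)\<close> is the image of its value at \<open>(v, v)\<close>, which is the class of one
  expression \<open>u\<close> in the two copies of \<open>v\<close>; so the imaginary addition \<open>\<mu>(a, b)\<close> is the value of \<open>u\<close>
  when the two copies of \<open>v\<close> are replaced by \<open>a\<close> and \<open>b\<close>.

  If \<open>X\<close> is 2-Engel, then \<open>[a, b]\<close> commutes with both \<open>a\<close> and \<open>b\<close>, so every expression in \<open>a\<close> and
  \<open>b\<close> has the form \<open>\<alpha>a + \<beta>b + \<gamma>[a, b]\<close>, with coefficients read off from the expression alone
  (\<open>lie_eval_two_engel\<close>).  For \<open>u\<close>, the condition that the splitting be a section of the canonical
  morphism to the product gives \<open>\<alpha> = \<beta> = 1\<close>.  Hence there is one scalar \<open>\<gamma>\<close> such that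
  \<open>\<mu>(a, b) = a + b + \<gamma>[a, b]\<close> on all of \<open>X\<close> (\<open>imaginary_addition_two_engel\<close>).

  Now let \<open>X\<close> be the product \<open>Y \<times> Y\<close>, which is again 2-Engel.  There \<open>\<mu>((a, 0), (y, y))\<close> is
  \<open>(a + \<gamma>[a, y] + y, y)\<close>.  The map \<open>a \<mapsto> a + \<gamma>[a, y]\<close> is bijective with inverse
  \<open>z \<mapsto> z - \<gamma>[z, y]\<close>, because \<open>[[z, y], y] = 0\<close>; therefore \<open>q(x, y) = z - \<gamma>[z, y]\<close> with \<open>z = x - y\<close>
  is the required retraction (\<open>two_engel_translation_inverse\<close>).
\<close>

section \<open>Morphisms of Lie algebras\<close>

lemma lie_homD:
  assumes "h \<in> lie_hom K L M"
  shows "x \<in> carrier L \<Longrightarrow> h x \<in> carrier M"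
    and "\<lbrakk>x \<in> carrier L; y \<in> carrier L\<rbrakk> \<Longrightarrow> h (x \<oplus>\<^bsub>L\<^esub> y) = h x \<oplus>\<^bsub>M\<^esub> h y"
    and "\<lbrakk>a \<in> carrier K; x \<in> carrier L\<rbrakk> \<Longrightarrow> h (a \<odot>\<^bsub>L\<^esub> x) = a \<odot>\<^bsub>M\<^esub> h x"
    and "\<lbrakk>x \<in> carrier L; y \<in> carrier L\<rbrakk> \<Longrightarrow> h (bracket L x y) = bracket M (h x) (h y)"
  using assms by (auto simp: lie_hom_def)

lemma lie_hom_zero:
  assumes "lie_algebra K L" "lie_algebra K M" "h \<in> lie_hom K L M"
  shows "h \<zero>\<^bsub>L\<^esub> = \<zero>\<^bsub>M\<^esub>"
proof -
  interpret L: lie_algebra K L by fact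
  interpret M: lie_algebra K M by fact
  have "h (\<zero>\<^bsub>K\<^esub> \<odot>\<^bsub>L\<^esub> \<zero>\<^bsub>L\<^esub>) = \<zero>\<^bsub>K\<^esub> \<odot>\<^bsub>M\<^esub> h \<zero>\<^bsub>L\<^esub>"
    by (rule lie_homD(3)[OF assms(3)]) auto
  then show ?thesis using lie_homD(1)[OF assms(3) L.M.zero_closed] by simp
qed

lemma lie_hom_comp:
  assumes "f \<in> lie_hom K L M" "g \<in> lie_hom K M N"
  shows "(\<lambda>x. g (f x)) \<in> lie_hom K L N"
  using assms by (auto simp: lie_hom_def Pi_iff)

lemma lie_iso_inverse:
  assumes "lie_algebra K L" "\<phi> \<in> lie_iso K L M"
  shows "inv_into (carrier L) \<phi> \<in> lie_hom K M L"
proof -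
  interpret L: lie_algebra K L by fact
  let ?i = "inv_into (carrier L) \<phi>"
  have h: "\<phi> \<in> lie_hom K L M" and b: "bij_betw \<phi> (carrier L) (carrier M)"
    using assms(2) by (auto simp: lie_iso_def)
  have c: "?i y \<in> carrier L" "\<phi> (?i y) = y" if "y \<in> carrier M" for y
    using that b by (auto simp: bij_betw_def inv_into_into f_inv_into_f)
  have i: "?i (\<phi> x) = x" if "x \<in> carrier L" for x
    using that b by (auto simp: bij_betw_def)
  show ?thesis
    unfolding lie_hom_def
  proof (intro CollectI conjI ballI)
    fix x y assume xy: "x \<in> carrier M" "y \<in> carrier M"
    have "\<phi> (?i x \<oplus>\<^bsub>L\<^esub> ?i y) = x \<oplus>\<^bsub>M\<^esub> y" using xy c lie_homD(2)[OF h] by simp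
    then show "?i (x \<oplus>\<^bsub>M\<^esub> y) = ?i x \<oplus>\<^bsub>L\<^esub> ?i y" using i[of "?i x \<oplus>\<^bsub>L\<^esub> ?i y"] xy c by simp
    have "\<phi> (bracket L (?i x) (?i y)) = bracket M x y" using xy c lie_homD(4)[OF h] by simp
    then show "?i (bracket M x y) = bracket L (?i x) (?i y)"
      using i[of "bracket L (?i x) (?i y)"] xy c by (simp add: L.bracket_closed)
  next
    fix a x assume xy: "a \<in> carrier K" "x \<in> carrier M"
    have "\<phi> (a \<odot>\<^bsub>L\<^esub> ?i x) = a \<odot>\<^bsub>M\<^esub> x" using xy c lie_homD(3)[OF h] by simp
    then show "?i (a \<odot>\<^bsub>M\<^esub> x) = a \<odot>\<^bsub>L\<^esub> ?i x" using i[of "a \<odot>\<^bsub>L\<^esub> ?i x"] xy c by simp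
  qed (use c in auto)
qed

lemma lie_algebra_transport:
  fixes M :: "('k, 'b) lie_alg" and \<phi> :: "'a \<Rightarrow> 'b"
  assumes "lie_algebra K M" "bij_betw \<phi> S (carrier M)"
  shows "\<exists>P :: ('k, 'a) lie_alg. lie_algebra K P \<and> \<phi> \<in> lie_iso K P M"
proof -
  interpret M: lie_algebra K M by fact
  define \<psi> where "\<psi> = inv_into S \<phi>"
  have c [simp]: "\<psi> y \<in> S" "\<phi> (\<psi> y) = y" if "y \<in> carrier M" for y
    using that assms(2) by (auto simp: \<psi>_def bij_betw_def inv_into_into f_inv_into_f)
  have i [simp]: "\<phi> x \<in> carrier M" "\<psi> (\<phi> x) = x" if "x \<in> S" for x
    using that assms(2) by (auto simp: \<psi>_def bij_betw_def)
  define P :: "('k, 'a) lie_alg" where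
    "P = \<lparr>carrier = S, mult = undefined, one = undefined, zero = \<psi> \<zero>\<^bsub>M\<^esub>,
          add = (\<lambda>x y. \<psi> (\<phi> x \<oplus>\<^bsub>M\<^esub> \<phi> y)), smult = (\<lambda>a x. \<psi> (a \<odot>\<^bsub>M\<^esub> \<phi> x)),
          bracket = (\<lambda>x y. \<psi> (bracket M (\<phi> x) (\<phi> y)))\<rparr>"
  have ops [simp]: "carrier P = S" "\<zero>\<^bsub>P\<^esub> = \<psi> \<zero>\<^bsub>M\<^esub>" "x \<oplus>\<^bsub>P\<^esub> y = \<psi> (\<phi> x \<oplus>\<^bsub>M\<^esub> \<phi> y)"
    "a \<odot>\<^bsub>P\<^esub> x = \<psi> (a \<odot>\<^bsub>M\<^esub> \<phi> x)" "bracket P x y = \<psi> (bracket M (\<phi> x) (\<phi> y))" for x y a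
    by (auto simp: P_def)
  have ag: "abelian_group P"
  proof (rule abelian_groupI)
    fix x assume "x \<in> carrier P"
    then show "\<exists>y\<in>carrier P. y \<oplus>\<^bsub>P\<^esub> x = \<zero>\<^bsub>P\<^esub>"
      by (intro bexI[of _ "\<psi> (\<ominus>\<^bsub>M\<^esub> \<phi> x)"]) (auto simp: M.M.l_neg)
  qed (auto simp: M.M.a_assoc M.M.a_comm M.M.a_lcomm)
  have md: "module K P"
    by (rule moduleI[OF M.is_cring ag])
      (auto simp: M.smult_l_distr M.smult_r_distr M.smult_assoc1)
  have ax: "lie_algebra_axioms K P"
    by (rule lie_algebra_axioms.intro)
      (auto simp: M.bracket_closed M.bracket_add_left M.bracket_add_right M.bracket_smult_left
        M.bracket_smult_right M.bracket_alternating M.jacobi)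
  have "lie_algebra K P"
    by (rule lie_algebra.intro[OF M.field_axioms md ax])
  moreover have "\<phi> \<in> lie_iso K P M"
    using assms(2) by (auto simp: lie_iso_def lie_hom_def M.bracket_closed)
  ultimately show ?thesis by blast
qed

text \<open>
  An infinite type is equipotent with its square, so the product of two Lie algebras over \<open>'u\<close> can
  be transported back to \<open>'u\<close>.
\<close>

lemma infinite_universe_contains_product:
  fixes L :: "('k, 'u) lie_alg" and M :: "('k, 'u) lie_alg"
  assumes "infinite (UNIV :: 'u set)" "lie_algebra K L" "lie_algebra K M"
  shows "\<exists>P :: ('k, 'u) lie_alg. lie_algebra K P \<and> lie_iso K P (lie_prod L M) \<noteq> {}"
proof -
  have "\<exists>h :: 'u \<times> 'u \<Rightarrow> 'u. bij_betw h (UNIV \<times> UNIV) UNIV"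
    unfolding card_of_ordIso by (rule card_of_Times_same_infinite[OF assms(1)])
  then obtain h :: "'u \<times> 'u \<Rightarrow> 'u" where h: "bij_betw h (UNIV \<times> UNIV) UNIV" by blast
  define C where "C = carrier (lie_prod L M)"
  have "bij_betw h C (h ` C)"
    by (rule bij_betw_subset[OF h]) auto
  from bij_betw_inv_into[OF this] have "bij_betw (inv_into C h) (h ` C) (carrier (lie_prod L M))"
    by (simp add: C_def)
  from lie_algebra_transport[OF lie_prod_lie_algebra[OF assms(2,3)] this]
  show ?thesis by blast
qed

text \<open>
  Morphisms commute with the evaluation of formal Lie expressions.  This is what reduces both the
  codiagonal and the two components of the canonical morphism to the product to evaluations.
\<close>

lemma hom_lie_eval:
  assumes "lie_algebra K N" "lie_algebra K N'" "h \<in> lie_hom K N N'"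
    and "f \<in> lie_hom K L N" "g \<in> lie_hom K M N" "u \<in> lie_terms K L M"
    and "\<And>x. x \<in> carrier L \<Longrightarrow> h (f x) = f' x" "\<And>y. y \<in> carrier M \<Longrightarrow> h (g y) = g' y"
  shows "h (lie_eval N f g u) = lie_eval N' f' g' u"
  using assms(6)
  by induction
    (auto simp: assms(7,8) lie_hom_zero[OF assms(1-3)] lie_homD[OF assms(3)]
      lie_eval_closed[OF assms(1,4,5)])

section \<open>Lie polynomials in two elements of a 2-Engel algebra\<close>

lemma (in lie_algebra) bracket_zero [simp]:
  assumes "x \<in> carrier L"
  shows "bracket L \<zero>\<^bsub>L\<^esub> x = \<zero>\<^bsub>L\<^esub>" "bracket L x \<zero>\<^bsub>L\<^esub> = \<zero>\<^bsub>L\<^esub>"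
  using bracket_smult_left[of "\<zero>\<^bsub>K\<^esub>" x x] bracket_smult_right[of "\<zero>\<^bsub>K\<^esub>" x x] assms
  by (simp_all add: bracket_closed)

lemma (in lie_algebra) bracket_anticomm:
  assumes "x \<in> carrier L" "y \<in> carrier L"
  shows "bracket L y x = \<ominus>\<^bsub>L\<^esub> bracket L x y"
proof -
  have "bracket L (x \<oplus>\<^bsub>L\<^esub> y) (x \<oplus>\<^bsub>L\<^esub> y) = bracket L y x \<oplus>\<^bsub>L\<^esub> bracket L x y"
    using assms bracket_alternating[of x] bracket_alternating[of y]
    by (simp add: bracket_add_left bracket_add_right bracket_closed)
  then have "bracket L y x \<oplus>\<^bsub>L\<^esub> bracket L x y = \<zero>\<^bsub>L\<^esub>"
    using bracket_alternating[of "x \<oplus>\<^bsub>L\<^esub> y"] assms by simp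
  then show ?thesis using assms by (metis M.minus_equality bracket_closed)
qed

lemma (in lie_algebra) two_engel_brackets:
  assumes "two_engel L" "x \<in> carrier L" "y \<in> carrier L"
  shows "bracket L (bracket L x y) y = \<zero>\<^bsub>L\<^esub>" "bracket L (bracket L x y) x = \<zero>\<^bsub>L\<^esub>"
    "bracket L x (bracket L x y) = \<zero>\<^bsub>L\<^esub>" "bracket L y (bracket L x y) = \<zero>\<^bsub>L\<^esub>"
proof -
  show 1: "bracket L (bracket L x y) y = \<zero>\<^bsub>L\<^esub>" using assms by (simp add: two_engel_def)
  have "bracket L (bracket L y x) x = \<zero>\<^bsub>L\<^esub>" using assms by (simp add: two_engel_def)
  moreover have "bracket L x y = (\<ominus>\<^bsub>K\<^esub> \<one>\<^bsub>K\<^esub>) \<odot>\<^bsub>L\<^esub> bracket L y x"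
    using assms by (simp add: bracket_anticomm[of y x] smult_l_minus bracket_closed)
  ultimately show 2: "bracket L (bracket L x y) x = \<zero>\<^bsub>L\<^esub>"
    using assms by (simp add: bracket_smult_left bracket_closed)
  show "bracket L x (bracket L x y) = \<zero>\<^bsub>L\<^esub>" "bracket L y (bracket L x y) = \<zero>\<^bsub>L\<^esub>"
    using assms 1 2 bracket_anticomm[of "bracket L x y"] by (simp_all add: bracket_closed)
qed

text \<open>
  The linear combination of \<open>x\<close>, \<open>y\<close> and their bracket with the given coefficients: the image of a
  general element of the Heisenberg algebra, which is the free 2-Engel algebra on two generators.
\<close>

definition heis :: "('k, 'a) lie_alg \<Rightarrow> 'a \<Rightarrow> 'a \<Rightarrow> 'k \<Rightarrow> 'k \<Rightarrow> 'k \<Rightarrow> 'a" where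
  "heis L x y \<alpha> \<beta> \<gamma> = \<alpha> \<odot>\<^bsub>L\<^esub> x \<oplus>\<^bsub>L\<^esub> (\<beta> \<odot>\<^bsub>L\<^esub> y \<oplus>\<^bsub>L\<^esub> \<gamma> \<odot>\<^bsub>L\<^esub> bracket L x y)"

lemma (in lie_algebra) heis_add:
  assumes "x \<in> carrier L" "y \<in> carrier L"
    and "\<alpha> \<in> carrier K" "\<beta> \<in> carrier K" "\<gamma> \<in> carrier K"
      "\<alpha>' \<in> carrier K" "\<beta>' \<in> carrier K" "\<gamma>' \<in> carrier K"
  shows "heis L x y \<alpha> \<beta> \<gamma> \<oplus>\<^bsub>L\<^esub> heis L x y \<alpha>' \<beta>' \<gamma>'
      = heis L x y (\<alpha> \<oplus>\<^bsub>K\<^esub> \<alpha>') (\<beta> \<oplus>\<^bsub>K\<^esub> \<beta>') (\<gamma> \<oplus>\<^bsub>K\<^esub> \<gamma>')"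
  using assms bracket_closed[OF assms(1,2)] by (simp add: heis_def smult_l_distr M.a_ac)

lemma (in lie_algebra) heis_smult:
  assumes "x \<in> carrier L" "y \<in> carrier L"
    and "a \<in> carrier K" "\<alpha> \<in> carrier K" "\<beta> \<in> carrier K" "\<gamma> \<in> carrier K"
  shows "a \<odot>\<^bsub>L\<^esub> heis L x y \<alpha> \<beta> \<gamma> = heis L x y (a \<otimes>\<^bsub>K\<^esub> \<alpha>) (a \<otimes>\<^bsub>K\<^esub> \<beta>) (a \<otimes>\<^bsub>K\<^esub> \<gamma>)"
  using assms bracket_closed[OF assms(1,2)] by (simp add: heis_def smult_r_distr smult_assoc1)

text \<open>
  The bracket of \<open>x\<close> and \<open>y\<close> commutes with \<open>x\<close> and with \<open>y\<close>, so only the bilinear alternating part in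
  the first two coefficients survives.
\<close>

lemma (in lie_algebra) heis_bracket:
  assumes "two_engel L" and xy: "x \<in> carrier L" "y \<in> carrier L"
    and cl: "\<alpha> \<in> carrier K" "\<beta> \<in> carrier K" "\<gamma> \<in> carrier K"
      "\<alpha>' \<in> carrier K" "\<beta>' \<in> carrier K" "\<gamma>' \<in> carrier K"
  shows "bracket L (heis L x y \<alpha> \<beta> \<gamma>) (heis L x y \<alpha>' \<beta>' \<gamma>')
      = heis L x y \<zero>\<^bsub>K\<^esub> \<zero>\<^bsub>K\<^esub> (\<alpha> \<otimes>\<^bsub>K\<^esub> \<beta>' \<ominus>\<^bsub>K\<^esub> \<beta> \<otimes>\<^bsub>K\<^esub> \<alpha>')"
proof -
  note b = bracket_closed[OF xy]
  have "bracket L (heis L x y \<alpha> \<beta> \<gamma>) (heis L x y \<alpha>' \<beta>' \<gamma>')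
      = (\<alpha> \<otimes>\<^bsub>K\<^esub> \<beta>') \<odot>\<^bsub>L\<^esub> bracket L x y \<oplus>\<^bsub>L\<^esub> \<ominus>\<^bsub>L\<^esub> ((\<beta> \<otimes>\<^bsub>K\<^esub> \<alpha>') \<odot>\<^bsub>L\<^esub> bracket L x y)"
    using xy cl b
    by (simp add: heis_def bracket_add_left bracket_add_right bracket_smult_left bracket_smult_right
        bracket_closed bracket_alternating two_engel_brackets[OF assms(1)] smult_assoc1[symmetric]
        bracket_anticomm[OF xy] smult_r_minus m_comm M.a_comm)
  also have "\<dots> = heis L x y \<zero>\<^bsub>K\<^esub> \<zero>\<^bsub>K\<^esub> (\<alpha> \<otimes>\<^bsub>K\<^esub> \<beta>' \<ominus>\<^bsub>K\<^esub> \<beta> \<otimes>\<^bsub>K\<^esub> \<alpha>')"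
    using xy cl b by (simp add: heis_def a_minus_def smult_l_distr smult_l_minus)
  finally show ?thesis .
qed

text \<open>
  The elements of the form \<open>heis X (f v) (g v) \<alpha> \<beta> \<gamma>\<close> contain the images of \<open>f\<close> and \<open>g\<close>, since \<open>v\<close>
  spans \<open>J\<close>, and are closed under all operations.  As the operations act on the coefficients by
  formulas in which \<open>X\<close> does not occur, the coefficients are chosen before \<open>X\<close>, \<open>f\<close> and \<open>g\<close>; this
  uniformity is essential for the use made of it.
\<close>

lemma lie_eval_two_engel:
  fixes K :: "('k, 'm) ring_scheme" and J :: "('k, 'a) lie_alg"
  assumes K: "field K" and v: "v \<in> carrier J"
    and gen: "\<And>w. w \<in> carrier J \<Longrightarrow> \<exists>c\<in>carrier K. w = c \<odot>\<^bsub>J\<^esub> v"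
    and u: "u \<in> lie_terms K J J"
  shows "\<exists>\<alpha>\<in>carrier K. \<exists>\<beta>\<in>carrier K. \<exists>\<gamma>\<in>carrier K.
    \<forall>X :: ('k, 'b) lie_alg. \<forall>f g. lie_algebra K X \<longrightarrow> two_engel X \<longrightarrow>
      f \<in> lie_hom K J X \<longrightarrow> g \<in> lie_hom K J X \<longrightarrow>
      lie_eval X f g u = heis X (f v) (g v) \<alpha> \<beta> \<gamma>"
proof -
  interpret K: field K by fact
  define E where "E s \<alpha> \<beta> \<gamma> \<longleftrightarrow> (\<forall>X :: ('k, 'b) lie_alg. \<forall>f g. lie_algebra K X \<longrightarrow> two_engel X \<longrightarrow>
      f \<in> lie_hom K J X \<longrightarrow> g \<in> lie_hom K J X \<longrightarrow>
      lie_eval X f g s = heis X (f v) (g v) \<alpha> \<beta> \<gamma>)" for s \<alpha> \<beta> \<gamma>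
  have E: "lie_eval X f g s = heis X (f v) (g v) \<alpha> \<beta> \<gamma>"
    if "E s \<alpha> \<beta> \<gamma>" "lie_algebra K X" "two_engel X" "f \<in> lie_hom K J X" "g \<in> lie_hom K J X"
    for X :: "('k, 'b) lie_alg" and f g s \<alpha> \<beta> \<gamma>
    using that by (simp add: E_def)
  have ex: "\<exists>\<alpha>\<in>carrier K. \<exists>\<beta>\<in>carrier K. \<exists>\<gamma>\<in>carrier K. E s \<alpha> \<beta> \<gamma>"
    if c: "\<alpha> \<in> carrier K" "\<beta> \<in> carrier K" "\<gamma> \<in> carrier K"
      and e: "\<And>X :: ('k, 'b) lie_alg. \<And>f g. \<lbrakk>lie_algebra K X; two_engel X; f \<in> lie_hom K J X;
        g \<in> lie_hom K J X; f v \<in> carrier X; g v \<in> carrier X\<rbrakk>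
        \<Longrightarrow> lie_eval X f g s = heis X (f v) (g v) \<alpha> \<beta> \<gamma>" for s \<alpha> \<beta> \<gamma>
  proof -
    have "E s \<alpha> \<beta> \<gamma>"
      unfolding E_def by (intro allI impI e lie_homD(1)[OF _ v])
    then show ?thesis using c by blast
  qed
  have "\<exists>\<alpha>\<in>carrier K. \<exists>\<beta>\<in>carrier K. \<exists>\<gamma>\<in>carrier K. E u \<alpha> \<beta> \<gamma>"
    using u
  proof induction
    case (InL w)
    obtain c where c: "c \<in> carrier K" "w = c \<odot>\<^bsub>J\<^esub> v" using gen[OF InL] by blast
    show ?case
    proof (rule ex[OF c(1) K.zero_closed K.zero_closed])
      fix X :: "('k, 'b) lie_alg" and f g
      assume X: "lie_algebra K X" and f: "f \<in> lie_hom K J X" and cl: "f v \<in> carrier X" "g v \<in> carrier X"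
      interpret X: lie_algebra K X by fact
      show "lie_eval X f g (lie_term.InL w) = heis X (f v) (g v) c \<zero>\<^bsub>K\<^esub> \<zero>\<^bsub>K\<^esub>"
        using c v cl by (simp add: heis_def lie_homD(3)[OF f] X.bracket_closed)
    qed
  next
    case (InR w)
    obtain c where c: "c \<in> carrier K" "w = c \<odot>\<^bsub>J\<^esub> v" using gen[OF InR] by blast
    show ?case
    proof (rule ex[OF K.zero_closed c(1) K.zero_closed])
      fix X :: "('k, 'b) lie_alg" and f g
      assume X: "lie_algebra K X" and g: "g \<in> lie_hom K J X" and cl: "f v \<in> carrier X" "g v \<in> carrier X"
      interpret X: lie_algebra K X by fact
      show "lie_eval X f g (lie_term.InR w) = heis X (f v) (g v) \<zero>\<^bsub>K\<^esub> c \<zero>\<^bsub>K\<^esub>"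
        using c v cl by (simp add: heis_def lie_homD(3)[OF g] X.bracket_closed)
    qed
  next
    case Zero
    show ?case
    proof (rule ex[OF K.zero_closed K.zero_closed K.zero_closed])
      fix X :: "('k, 'b) lie_alg" and f g
      assume X: "lie_algebra K X" and cl: "f v \<in> carrier X" "g v \<in> carrier X"
      interpret X: lie_algebra K X by fact
      show "lie_eval X f g lie_term.Zero = heis X (f v) (g v) \<zero>\<^bsub>K\<^esub> \<zero>\<^bsub>K\<^esub> \<zero>\<^bsub>K\<^esub>"
        using cl by (simp add: heis_def X.bracket_closed)
    qed
  next
    case (Add s s')
    then obtain \<alpha> \<beta> \<gamma> \<alpha>' \<beta>' \<gamma>' where c: "\<alpha> \<in> carrier K" "\<beta> \<in> carrier K" "\<gamma> \<in> carrier K"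
      "\<alpha>' \<in> carrier K" "\<beta>' \<in> carrier K" "\<gamma>' \<in> carrier K" and e: "E s \<alpha> \<beta> \<gamma>" "E s' \<alpha>' \<beta>' \<gamma>'"
      by blast
    show ?case
      by (rule ex[of "\<alpha> \<oplus>\<^bsub>K\<^esub> \<alpha>'" "\<beta> \<oplus>\<^bsub>K\<^esub> \<beta>'" "\<gamma> \<oplus>\<^bsub>K\<^esub> \<gamma>'"])
        (use c in \<open>simp_all add: E[OF e(1)] E[OF e(2)] lie_algebra.heis_add[of K]\<close>)
  next
    case (Smult a s)
    then obtain \<alpha> \<beta> \<gamma> where c: "\<alpha> \<in> carrier K" "\<beta> \<in> carrier K" "\<gamma> \<in> carrier K"
      and e: "E s \<alpha> \<beta> \<gamma>"
      by blast
    show ?case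
      by (rule ex[of "a \<otimes>\<^bsub>K\<^esub> \<alpha>" "a \<otimes>\<^bsub>K\<^esub> \<beta>" "a \<otimes>\<^bsub>K\<^esub> \<gamma>"])
        (use c Smult(1) in \<open>simp_all add: E[OF e] lie_algebra.heis_smult[of K]\<close>)
  next
    case (Bracket s s')
    then obtain \<alpha> \<beta> \<gamma> \<alpha>' \<beta>' \<gamma>' where c: "\<alpha> \<in> carrier K" "\<beta> \<in> carrier K" "\<gamma> \<in> carrier K"
      "\<alpha>' \<in> carrier K" "\<beta>' \<in> carrier K" "\<gamma>' \<in> carrier K" and e: "E s \<alpha> \<beta> \<gamma>" "E s' \<alpha>' \<beta>' \<gamma>'"
      by blast
    show ?case
      by (rule ex[of "\<zero>\<^bsub>K\<^esub>" "\<zero>\<^bsub>K\<^esub>" "\<alpha> \<otimes>\<^bsub>K\<^esub> \<beta>' \<ominus>\<^bsub>K\<^esub> \<beta> \<otimes>\<^bsub>K\<^esub> \<alpha>'"])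
        (use c in \<open>simp_all add: E[OF e(1)] E[OF e(2)] lie_algebra.heis_bracket[of K]\<close>)
  qed
  then show ?thesis by (simp add: E_def)
qed

section \<open>One-dimensional Lie algebras\<close>

definition line :: "('k, 'm) ring_scheme \<Rightarrow> ('k, 'a) lie_alg \<Rightarrow> 'a \<Rightarrow> ('k, 'a) lie_alg" where
  "line K L v = L\<lparr>carrier := (\<lambda>c. c \<odot>\<^bsub>L\<^esub> v) ` carrier K\<rparr>"

lemma line_simps [simp]:
  "carrier (line K L v) = (\<lambda>c. c \<odot>\<^bsub>L\<^esub> v) ` carrier K"
  "\<zero>\<^bsub>line K L v\<^esub> = \<zero>\<^bsub>L\<^esub>" "add (line K L v) = add L" "smult (line K L v) = smult L"
  "bracket (line K L v) = bracket L"
  by (simp_all add: line_def)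

context lie_algebra
begin

lemma line_bracket:
  assumes "v \<in> carrier L" "x \<in> carrier (line K L v)" "y \<in> carrier (line K L v)"
  shows "bracket L x y = \<zero>\<^bsub>L\<^esub>"
  using assms by (auto simp: bracket_smult_left bracket_smult_right bracket_alternating)

lemma line_closed:
  assumes "v \<in> carrier L"
  shows "x \<in> carrier (line K L v) \<Longrightarrow> x \<in> carrier L"
    and "\<lbrakk>x \<in> carrier (line K L v); y \<in> carrier (line K L v)\<rbrakk> \<Longrightarrow> x \<oplus>\<^bsub>L\<^esub> y \<in> carrier (line K L v)"
    and "\<lbrakk>a \<in> carrier K; x \<in> carrier (line K L v)\<rbrakk> \<Longrightarrow> a \<odot>\<^bsub>L\<^esub> x \<in> carrier (line K L v)"
    and "\<zero>\<^bsub>L\<^esub> \<in> carrier (line K L v)"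
proof -
  show "x \<oplus>\<^bsub>L\<^esub> y \<in> carrier (line K L v)" if "x \<in> carrier (line K L v)" "y \<in> carrier (line K L v)"
    using that assms by (auto simp: smult_l_distr[symmetric])
  show "a \<odot>\<^bsub>L\<^esub> x \<in> carrier (line K L v)" if "a \<in> carrier K" "x \<in> carrier (line K L v)"
    using that assms by (auto simp: smult_assoc1[symmetric])
  show "\<zero>\<^bsub>L\<^esub> \<in> carrier (line K L v)"
    using assms by (auto intro!: image_eqI[of _ _ "\<zero>\<^bsub>K\<^esub>"])
qed (use assms in auto)

lemma line_lie_algebra:
  assumes v: "v \<in> carrier L"
  shows "lie_algebra K (line K L v)"
proof -
  note cl = line_closed[OF v]
  have ag: "abelian_group (line K L v)"
  proof (rule abelian_groupI)
    fix x assume x: "x \<in> carrier (line K L v)"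
    have "(\<ominus>\<^bsub>K\<^esub> \<one>\<^bsub>K\<^esub>) \<odot>\<^bsub>L\<^esub> x \<oplus>\<^bsub>L\<^esub> x = \<zero>\<^bsub>L\<^esub>"
      using cl(1)[OF x] by (simp add: smult_l_minus M.l_neg)
    moreover have "(\<ominus>\<^bsub>K\<^esub> \<one>\<^bsub>K\<^esub>) \<odot>\<^bsub>L\<^esub> x \<in> carrier (line K L v)" using cl(3) x by simp
    ultimately show "\<exists>y\<in>carrier (line K L v). y \<oplus>\<^bsub>line K L v\<^esub> x = \<zero>\<^bsub>line K L v\<^esub>"
      by (intro bexI[of _ "(\<ominus>\<^bsub>K\<^esub> \<one>\<^bsub>K\<^esub>) \<odot>\<^bsub>L\<^esub> x"]) simp_all
  qed (use cl in \<open>auto simp del: line_simps(1) simp: M.a_assoc intro: M.a_comm\<close>)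
  have md: "module K (line K L v)"
    by (rule moduleI[OF is_cring ag])
      (use cl in \<open>auto simp del: line_simps(1) simp: smult_l_distr smult_r_distr smult_assoc1\<close>)
  have ax: "lie_algebra_axioms K (line K L v)"
    by (rule lie_algebra_axioms.intro)
      (use cl v in \<open>simp_all del: line_simps(1) add: line_bracket bracket_closed\<close>)
  show ?thesis by (rule lie_algebra.intro[OF field_axioms md ax])
qed

lemma line_two_engel:
  assumes "v \<in> carrier L"
  shows "two_engel (line K L v)"
  using assms line_closed[OF assms]
  by (auto simp del: line_simps(1) simp add: two_engel_def line_bracket)

lemma smult_eq_iff:
  assumes "v \<in> carrier L" "v \<noteq> \<zero>\<^bsub>L\<^esub>" "c \<in> carrier K" "d \<in> carrier K"
  shows "c \<odot>\<^bsub>L\<^esub> v = d \<odot>\<^bsub>L\<^esub> v \<longleftrightarrow> c = d"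
proof
  assume eq: "c \<odot>\<^bsub>L\<^esub> v = d \<odot>\<^bsub>L\<^esub> v"
  let ?e = "c \<ominus>\<^bsub>K\<^esub> d"
  have z: "?e \<odot>\<^bsub>L\<^esub> v = \<zero>\<^bsub>L\<^esub>"
    using assms eq by (simp add: a_minus_def smult_l_distr smult_l_minus M.r_neg)
  have e: "?e = \<zero>\<^bsub>K\<^esub>"
  proof (rule ccontr)
    assume "?e \<noteq> \<zero>\<^bsub>K\<^esub>"
    then have u: "?e \<in> Units K" using assms field_Units by simp
    have "v = (inv\<^bsub>K\<^esub> ?e \<otimes>\<^bsub>K\<^esub> ?e) \<odot>\<^bsub>L\<^esub> v" using u assms by simp
    also have "\<dots> = \<zero>\<^bsub>L\<^esub>" using u assms z by (subst smult_assoc1) auto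
    finally show False using assms by simp
  qed
  have "\<ominus>\<^bsub>K\<^esub> (\<ominus>\<^bsub>K\<^esub> d) = c"
    by (rule abelian_group.minus_equality[OF ring.axioms(1)[OF ring_axioms]])
      (use e assms in \<open>simp_all add: a_minus_def\<close>)
  then show "c = d" using assms by simp
qed simp

text \<open>
  The coefficient of an element of the line is unique because \<open>v\<close> is nonzero, and the line is free
  on \<open>v\<close> as a Lie algebra because a single generator has no nonzero brackets.
\<close>

lemma line_hom_exists:
  assumes v: "v \<in> carrier L" "v \<noteq> \<zero>\<^bsub>L\<^esub>" and X: "lie_algebra K X" and a: "a \<in> carrier X"
  shows "\<exists>f \<in> lie_hom K (line K L v) X. f v = a"
proof -
  interpret X: lie_algebra K X by fact
  define f where "f x = (THE c. c \<in> carrier K \<and> x = c \<odot>\<^bsub>L\<^esub> v) \<odot>\<^bsub>X\<^esub> a" for x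
  have f: "f (c \<odot>\<^bsub>L\<^esub> v) = c \<odot>\<^bsub>X\<^esub> a" if "c \<in> carrier K" for c
  proof -
    have "(THE d. d \<in> carrier K \<and> c \<odot>\<^bsub>L\<^esub> v = d \<odot>\<^bsub>L\<^esub> v) = c"
      using that smult_eq_iff[OF v] by (intro the_equality) auto
    then show ?thesis by (simp add: f_def)
  qed
  have z: "f \<zero>\<^bsub>L\<^esub> = \<zero>\<^bsub>X\<^esub>" using f[of "\<zero>\<^bsub>K\<^esub>"] v a by simp
  have "f v = a" using f[of "\<one>\<^bsub>K\<^esub>"] v a by simp
  moreover have "f \<in> lie_hom K (line K L v) X"
    using v a
    by (auto simp: lie_hom_def f z smult_l_distr[symmetric] smult_assoc1[symmetric]
        X.smult_l_distr X.smult_assoc1 bracket_smult_left bracket_smult_right bracket_alternating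
        X.bracket_smult_left X.bracket_smult_right X.bracket_alternating)
  ultimately show ?thesis by blast
qed

end

section \<open>The imaginary addition of a 2-Engel algebra\<close>

lemma codiagonal_hom:
  assumes X: "lie_algebra K X"
  shows "codiagonal X \<in> lie_hom K (lie_coprod K X X) X"
    and "x \<in> carrier X \<Longrightarrow> codiagonal X (coprod_inl K X X x) = x"
    and "x \<in> carrier X \<Longrightarrow> codiagonal X (coprod_inr K X X x) = x"
proof -
  have "(\<lambda>x. x) \<in> lie_hom K X X" by (auto simp: lie_hom_def)
  from copair_hom[OF X X X this this]
  show "codiagonal X \<in> lie_hom K (lie_coprod K X X) X"
    "x \<in> carrier X \<Longrightarrow> codiagonal X (coprod_inl K X X x) = x"
    "x \<in> carrier X \<Longrightarrow> codiagonal X (coprod_inr K X X x) = x"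
    by (simp_all add: codiagonal_def)
qed

lemma codiagonal_coprod_map:
  assumes L: "lie_algebra K L" and M: "lie_algebra K M" and X: "lie_algebra K X"
    and f: "f \<in> lie_hom K L X" and g: "g \<in> lie_hom K M X" and u: "u \<in> lie_terms K L M"
  shows "codiagonal X (coprod_map K X X f g (coprod_class K L M u)) = lie_eval X f g u"
proof -
  let ?C = "lie_coprod K X X"
  have C: "lie_algebra K ?C" by (rule lie_coprod_lie_algebra[OF X X])
  have homs: "coprod_inl K X X \<circ> f \<in> lie_hom K L ?C" "coprod_inr K X X \<circ> g \<in> lie_hom K M ?C"
    using lie_hom_comp[OF f coprod_inl_hom[OF X X]] lie_hom_comp[OF g coprod_inr_hom[OF X X]]
    by (simp_all add: comp_def)
  show ?thesis
    unfolding coprod_map_def copair_class[OF L M C homs u]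
    using codiagonal_hom[OF X] lie_homD(1)[OF f] lie_homD(1)[OF g]
    by (intro hom_lie_eval[OF C X _ homs u]) auto
qed

lemma coprod_to_prod_class:
  assumes L: "lie_algebra K L" and M: "lie_algebra K M" and u: "u \<in> lie_terms K L M"
  shows "coprod_to_prod L M (coprod_class K L M u)
    = (lie_eval L (\<lambda>x. x) (\<lambda>y. \<zero>\<^bsub>L\<^esub>) u, lie_eval M (\<lambda>x. \<zero>\<^bsub>M\<^esub>) (\<lambda>y. y) u)"
proof -
  interpret L: lie_algebra K L by fact
  interpret M: lie_algebra K M by fact
  let ?P = "lie_prod L M"
  have P: "lie_algebra K ?P" by (rule lie_prod_lie_algebra[OF L M])
  have homs: "(\<lambda>x. (x, \<zero>\<^bsub>M\<^esub>)) \<in> lie_hom K L ?P" "(\<lambda>y. (\<zero>\<^bsub>L\<^esub>, y)) \<in> lie_hom K M ?P"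
    by (auto simp: lie_hom_def lie_prod_def)
  have projs: "fst \<in> lie_hom K ?P L" "snd \<in> lie_hom K ?P M"
    by (auto simp: lie_hom_def lie_prod_def)
  show ?thesis
    unfolding coprod_to_prod_def copair_class[OF L M P homs u]
    using hom_lie_eval[OF P L projs(1) homs u, of "\<lambda>x. x" "\<lambda>y. \<zero>\<^bsub>L\<^esub>"]
      hom_lie_eval[OF P M projs(2) homs u, of "\<lambda>x. \<zero>\<^bsub>M\<^esub>" "\<lambda>y. y"]
    by (auto intro: prod_eqI)
qed

lemma natural_imaginary_splittingD:
  assumes "natural_imaginary_splitting K t" "lie_algebra K X" "lie_algebra K Y"
    "x \<in> carrier X" "y \<in> carrier Y"
  shows "t X Y (x, y) \<in> carrier (lie_coprod K X Y)"
    and "coprod_to_prod X Y (t X Y (x, y)) = (x, y)"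
    and "\<lbrakk>lie_algebra K X'; lie_algebra K Y'; f \<in> lie_hom K X X'; g \<in> lie_hom K Y Y'\<rbrakk>
      \<Longrightarrow> coprod_map K X' Y' f g (t X Y (x, y)) = t X' Y' (f x, g y)"
  using assms unfolding natural_imaginary_splitting_def by blast+

text \<open>
  The scalar is obtained from the splitting at the line through a nonzero element of \<open>X\<close>, which lies
  in the same universe as \<open>X\<close>.  A one-dimensional algebra over \<open>'u\<close> need not exist when \<open>X\<close> is zero,
  as the field may have larger cardinality than \<open>'u\<close>; but then the formula is trivial.
\<close>

proposition imaginary_addition_two_engel:
  fixes X :: "('k, 'u) lie_alg" and t :: "('k, 'u) splitting"
  assumes X: "lie_algebra K X" and engel: "two_engel X" and t: "natural_imaginary_splitting K t"
  shows "\<exists>\<gamma>\<in>carrier K. \<forall>a\<in>carrier X. \<forall>b\<in>carrier X.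
    imaginary_addition t X (a, b) = a \<oplus>\<^bsub>X\<^esub> (b \<oplus>\<^bsub>X\<^esub> \<gamma> \<odot>\<^bsub>X\<^esub> bracket X a b)"
proof (cases "carrier X = {\<zero>\<^bsub>X\<^esub>}")
  case True
  interpret X: lie_algebra K X by fact
  have "imaginary_addition t X (a, b) \<in> carrier X" if "a \<in> carrier X" "b \<in> carrier X" for a b
    using natural_imaginary_splittingD(1)[OF t X X that] lie_homD(1)[OF codiagonal_hom(1)[OF X]]
    by (simp add: imaginary_addition_def)
  moreover have "a \<oplus>\<^bsub>X\<^esub> (b \<oplus>\<^bsub>X\<^esub> \<zero>\<^bsub>K\<^esub> \<odot>\<^bsub>X\<^esub> bracket X a b) \<in> carrier X"
    if "a \<in> carrier X" "b \<in> carrier X" for a b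
    using that by (simp add: X.bracket_closed)
  ultimately show ?thesis using True by (intro bexI[of _ "\<zero>\<^bsub>K\<^esub>"]) auto
next
  case False
  interpret X: lie_algebra K X by fact
  from False obtain v where v: "v \<in> carrier X" "v \<noteq> \<zero>\<^bsub>X\<^esub>" using X.M.zero_closed by blast
  define J where "J = line K X v"
  have J: "lie_algebra K J" "two_engel J"
    unfolding J_def by (rule X.line_lie_algebra[OF v(1)], rule X.line_two_engel[OF v(1)])
  interpret J: lie_algebra K J by fact
  have vJ: "v \<in> carrier J" using v by (auto simp: J_def intro!: image_eqI[of _ _ "\<one>\<^bsub>K\<^esub>"])
  have gen: "\<exists>c\<in>carrier K. w = c \<odot>\<^bsub>J\<^esub> v" if "w \<in> carrier J" for w
    using that by (auto simp: J_def)
  obtain u where u: "u \<in> lie_terms K J J" and tu: "t J J (v, v) = coprod_class K J J u"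
    using natural_imaginary_splittingD(1)[OF t J(1) J(1) vJ vJ] by (auto simp: lie_coprod_carrier)
  obtain \<alpha> \<beta> \<gamma> where c: "\<alpha> \<in> carrier K" "\<beta> \<in> carrier K" "\<gamma> \<in> carrier K"
    and eval: "\<And>(N :: ('k, 'u) lie_alg) f g. \<lbrakk>lie_algebra K N; two_engel N; f \<in> lie_hom K J N; g \<in> lie_hom K J N\<rbrakk>
      \<Longrightarrow> lie_eval N f g u = heis N (f v) (g v) \<alpha> \<beta> \<gamma>"
    using lie_eval_two_engel[OF X.field_axioms vJ gen u] by metis
  have homs: "(\<lambda>x. x) \<in> lie_hom K J J" "(\<lambda>x. \<zero>\<^bsub>J\<^esub>) \<in> lie_hom K J J"
    by (auto simp: lie_hom_def)
  (* The line itself is 2-Engel, so the two components of the canonical morphism, which replace one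
     copy of v by 0, are evaluations to which the same coefficients apply. *)
  have "heis J v \<zero>\<^bsub>J\<^esub> \<alpha> \<beta> \<gamma> = v" "heis J \<zero>\<^bsub>J\<^esub> v \<alpha> \<beta> \<gamma> = v"
    using natural_imaginary_splittingD(2)[OF t J(1) J(1) vJ vJ]
    by (simp_all add: tu coprod_to_prod_class[OF J(1) J(1) u] eval[OF J homs] eval[OF J homs(2,1)])
  then have "\<alpha> \<odot>\<^bsub>J\<^esub> v = v" "\<beta> \<odot>\<^bsub>J\<^esub> v = v"
    using c vJ by (simp_all add: heis_def)
  then have 1: "\<alpha> = \<one>\<^bsub>K\<^esub>" "\<beta> = \<one>\<^bsub>K\<^esub>"
    using X.smult_eq_iff[OF v _ X.one_closed] c v by (simp_all add: J_def)
  have "imaginary_addition t X (a, b) = a \<oplus>\<^bsub>X\<^esub> (b \<oplus>\<^bsub>X\<^esub> \<gamma> \<odot>\<^bsub>X\<^esub> bracket X a b)"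
    if ab: "a \<in> carrier X" "b \<in> carrier X" for a b
  proof -
    obtain f g where fg: "f \<in> lie_hom K J X" "g \<in> lie_hom K J X" "f v = a" "g v = b"
      using X.line_hom_exists[OF v X] ab unfolding J_def by meson
    have "t X X (a, b) = coprod_map K X X f g (t J J (v, v))"
      using natural_imaginary_splittingD(3)[OF t J(1) J(1) vJ vJ X X fg(1,2)] fg by simp
    then have "imaginary_addition t X (a, b) = lie_eval X f g u"
      by (simp add: imaginary_addition_def tu codiagonal_coprod_map[OF J(1) J(1) X fg(1,2) u])
    then show ?thesis using ab fg by (simp add: eval[OF X engel] heis_def 1)
  qed
  then show ?thesis using c by blast
qed

section \<open>The Schreier retraction\<close>

text \<open>
  The operator \<open>z \<mapsto> \<gamma>[z, y]\<close> has square zero, so adding it to and subtracting it from the identity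
  give mutually inverse maps.
\<close>

lemma (in lie_algebra) two_engel_translation_inverse:
  assumes "two_engel L" "\<gamma> \<in> carrier K" "z \<in> carrier L" "y \<in> carrier L"
  shows "(z \<ominus>\<^bsub>L\<^esub> \<gamma> \<odot>\<^bsub>L\<^esub> bracket L z y) \<oplus>\<^bsub>L\<^esub> \<gamma> \<odot>\<^bsub>L\<^esub> bracket L (z \<ominus>\<^bsub>L\<^esub> \<gamma> \<odot>\<^bsub>L\<^esub> bracket L z y) y = z"
    and "(z \<oplus>\<^bsub>L\<^esub> \<gamma> \<odot>\<^bsub>L\<^esub> bracket L z y) \<ominus>\<^bsub>L\<^esub> \<gamma> \<odot>\<^bsub>L\<^esub> bracket L (z \<oplus>\<^bsub>L\<^esub> \<gamma> \<odot>\<^bsub>L\<^esub> bracket L z y) y = z"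
proof -
  have b: "bracket L z y \<in> carrier L" using assms by (simp add: bracket_closed)
  have "bracket L (z \<oplus>\<^bsub>L\<^esub> \<delta> \<odot>\<^bsub>L\<^esub> bracket L z y) y = bracket L z y" if "\<delta> \<in> carrier K" for \<delta>
    using that assms b
    by (simp add: bracket_add_left bracket_smult_left bracket_closed two_engel_brackets)
  note e = this[OF assms(2)] this[of "\<ominus>\<^bsub>K\<^esub> \<gamma>"]
  show "(z \<ominus>\<^bsub>L\<^esub> \<gamma> \<odot>\<^bsub>L\<^esub> bracket L z y) \<oplus>\<^bsub>L\<^esub> \<gamma> \<odot>\<^bsub>L\<^esub> bracket L (z \<ominus>\<^bsub>L\<^esub> \<gamma> \<odot>\<^bsub>L\<^esub> bracket L z y) y = z"
    using e(2) assms b by (simp add: M.minus_eq smult_l_minus M.a_assoc M.l_neg)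
  show "(z \<oplus>\<^bsub>L\<^esub> \<gamma> \<odot>\<^bsub>L\<^esub> bracket L z y) \<ominus>\<^bsub>L\<^esub> \<gamma> \<odot>\<^bsub>L\<^esub> bracket L (z \<oplus>\<^bsub>L\<^esub> \<gamma> \<odot>\<^bsub>L\<^esub> bracket L z y) y = z"
    using e(1) assms b by (simp add: M.minus_eq M.a_assoc M.r_neg)
qed

lemma two_engel_lie_prod:
  assumes "two_engel L" "two_engel M"
  shows "two_engel (lie_prod L M)"
  using assms by (auto simp: two_engel_def lie_prod_def)

lemma two_engel_lie_iso:
  assumes L: "lie_algebra K L" and M: "lie_algebra K M" and "\<phi> \<in> lie_iso K L M" "two_engel M"
  shows "two_engel L"
  unfolding two_engel_def
proof (intro ballI)
  interpret L: lie_algebra K L by fact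
  fix x y assume xy: "x \<in> carrier L" "y \<in> carrier L"
  have h: "\<phi> \<in> lie_hom K L M" and inj: "inj_on \<phi> (carrier L)"
    using assms(3) by (auto simp: lie_iso_def bij_betw_def)
  have "\<phi> (bracket L (bracket L x y) y) = \<phi> \<zero>\<^bsub>L\<^esub>"
    using assms(4) xy
    by (simp add: lie_homD[OF h] L.bracket_closed lie_hom_zero[OF L M h] two_engel_def)
  then show "bracket L (bracket L x y) y = \<zero>\<^bsub>L\<^esub>"
    using inj_onD[OF inj] xy by (simp add: L.bracket_closed)
qed

theorem proposition12p1:
  fixes K :: "('k, 'm) ring_scheme"
    and Y :: "('k, 'u) lie_alg"
    and t :: "('k, 'u) splitting"
  assumes "field K"
    and "infinite (UNIV :: 'u set)"
    and "lie_algebra K Y"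
    and "two_engel Y"
    and "natural_imaginary_splitting K t"
  shows "intrinsic_schreier_special K t Y"
  unfolding intrinsic_schreier_special_def
proof (intro conjI allI impI)
  show "\<exists>P :: ('k, 'u) lie_alg. lie_algebra K P \<and> lie_iso K P (lie_prod Y Y) \<noteq> {}"
    by (rule infinite_universe_contains_product[OF assms(2,3,3)])
next
  fix P :: "('k, 'u) lie_alg" and \<phi>
  assume P: "lie_algebra K P" and \<phi>: "\<phi> \<in> lie_iso K P (lie_prod Y Y)"
  interpret Y: lie_algebra K Y by fact
  interpret P: lie_algebra K P by fact
  have YY: "lie_algebra K (lie_prod Y Y)" by (rule lie_prod_lie_algebra[OF assms(3,3)])
  have h: "\<phi> \<in> lie_hom K P (lie_prod Y Y)" and bij: "bij_betw \<phi> (carrier P) (carrier (lie_prod Y Y))"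
    using \<phi> by (auto simp: lie_iso_def)
  let ?\<psi> = "inv_into (carrier P) \<phi>"
  have \<psi>h: "?\<psi> \<in> lie_hom K (lie_prod Y Y) P" by (rule lie_iso_inverse[OF P \<phi>])
  have \<psi>: "?\<psi> (x, y) \<in> carrier P" "\<phi> (?\<psi> (x, y)) = (x, y)" if "x \<in> carrier Y" "y \<in> carrier Y" for x y
    using that bij
    by (auto simp: bij_betw_def lie_prod_def intro!: inv_into_into f_inv_into_f)
  have \<phi>c: "fst (\<phi> p) \<in> carrier Y" "snd (\<phi> p) \<in> carrier Y" if "p \<in> carrier P" for p
    using lie_homD(1)[OF h that] by (auto simp: lie_prod_def)
  have inj: "p = p'" if "p \<in> carrier P" "p' \<in> carrier P" "\<phi> p = \<phi> p'" for p p'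
    using that bij by (auto simp: bij_betw_def dest: inj_onD)
  have engel: "two_engel P"
    by (rule two_engel_lie_iso[OF P YY \<phi> two_engel_lie_prod[OF assms(4,4)]])
  obtain \<gamma> where \<gamma>: "\<gamma> \<in> carrier K" and add: "\<And>a b. \<lbrakk>a \<in> carrier P; b \<in> carrier P\<rbrakk> \<Longrightarrow>
      imaginary_addition t P (a, b) = a \<oplus>\<^bsub>P\<^esub> (b \<oplus>\<^bsub>P\<^esub> \<gamma> \<odot>\<^bsub>P\<^esub> bracket P a b)"
    using imaginary_addition_two_engel[OF P engel assms(5)] by blast
  let ?k = "\<lambda>y. ?\<psi> (y, \<zero>\<^bsub>Y\<^esub>)" and ?s = "\<lambda>y. ?\<psi> (y, y)"
  have addc: "imaginary_addition t P (?k a, ?s y) \<in> carrier P"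
    and \<phi>add: "\<phi> (imaginary_addition t P (?k a, ?s y)) = ((a \<oplus>\<^bsub>Y\<^esub> \<gamma> \<odot>\<^bsub>Y\<^esub> bracket Y a y) \<oplus>\<^bsub>Y\<^esub> y, y)"
    if ay: "a \<in> carrier Y" "y \<in> carrier Y" for a y
  proof -
    show "imaginary_addition t P (?k a, ?s y) \<in> carrier P"
      using ay \<gamma> \<psi> by (simp add: add P.bracket_closed)
    have "\<phi> (imaginary_addition t P (?k a, ?s y))
        = (a \<oplus>\<^bsub>Y\<^esub> (y \<oplus>\<^bsub>Y\<^esub> \<gamma> \<odot>\<^bsub>Y\<^esub> bracket Y a y), y)"
      using ay \<gamma> \<psi>
      by (simp add: add P.bracket_closed lie_homD[OF h]) (simp add: lie_prod_def)
    then show "\<phi> (imaginary_addition t P (?k a, ?s y)) = ((a \<oplus>\<^bsub>Y\<^esub> \<gamma> \<odot>\<^bsub>Y\<^esub> bracket Y a y) \<oplus>\<^bsub>Y\<^esub> y, y)"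
      using ay \<gamma> by (simp add: Y.M.a_ac Y.bracket_closed)
  qed
  (* q0 inverts the map a \<mapsto> a + \<gamma>[a, y] that appears in the first component of \<phi>add. *)
  define q0 where "q0 z y = z \<ominus>\<^bsub>Y\<^esub> \<gamma> \<odot>\<^bsub>Y\<^esub> bracket Y z y" for z y
  define q where "q p = q0 (fst (\<phi> p) \<ominus>\<^bsub>Y\<^esub> snd (\<phi> p)) (snd (\<phi> p))" for p
  have q0c: "q0 z y \<in> carrier Y" if "z \<in> carrier Y" "y \<in> carrier Y" for z y
    using that \<gamma> by (simp add: q0_def Y.bracket_closed)
  have qc: "q p \<in> carrier Y" if "p \<in> carrier P" for p
    using \<phi>c[OF that] by (simp add: q_def q0c)
  show "intrinsic_schreier K t P Y Y (\<lambda>p. snd (\<phi> p)) ?s ?k"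
    unfolding intrinsic_schreier_def
  proof (intro conjI ballI bexI[of _ q])
    have "snd \<in> lie_hom K (lie_prod Y Y) Y" by (auto simp: lie_hom_def lie_prod_def)
    from lie_hom_comp[OF h this] show "(\<lambda>p. snd (\<phi> p)) \<in> lie_hom K P Y" .
    have "(\<lambda>y. (y, y)) \<in> lie_hom K Y (lie_prod Y Y)" by (auto simp: lie_hom_def lie_prod_def)
    from lie_hom_comp[OF this \<psi>h] show "?s \<in> lie_hom K Y P" .
    show "snd (\<phi> (?s y)) = y" if "y \<in> carrier Y" for y
      using that by (simp add: \<psi>)
    show "is_kernel K Y P Y ?k (\<lambda>p. snd (\<phi> p))"
      unfolding is_kernel_def
    proof (intro conjI)
      have "(\<lambda>y. (y, \<zero>\<^bsub>Y\<^esub>)) \<in> lie_hom K Y (lie_prod Y Y)" by (auto simp: lie_hom_def lie_prod_def)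
      from lie_hom_comp[OF this \<psi>h] show "?k \<in> lie_hom K Y P" .
      show "inj_on ?k (carrier Y)"
        by (rule inj_on_inverseI[of _ "\<lambda>p. fst (\<phi> p)"]) (simp add: \<psi>)
      show "?k ` carrier Y = {x \<in> carrier P. snd (\<phi> x) = \<zero>\<^bsub>Y\<^esub>}"
      proof (intro equalityI subsetI)
        fix p assume p: "p \<in> {x \<in> carrier P. snd (\<phi> x) = \<zero>\<^bsub>Y\<^esub>}"
        then have "?k (fst (\<phi> p)) = p"
          by (intro inj) (auto simp: \<psi> \<phi>c prod_eq_iff)
        then show "p \<in> ?k ` carrier Y" using p \<phi>c by force
      qed (auto simp: \<psi>)
    qed
  next
    fix p assume p: "p \<in> carrier P"
    let ?x = "fst (\<phi> p)" and ?y = "snd (\<phi> p)"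
    have xy: "?x \<in> carrier Y" "?y \<in> carrier Y" using \<phi>c p by auto
    have "q p \<oplus>\<^bsub>Y\<^esub> \<gamma> \<odot>\<^bsub>Y\<^esub> bracket Y (q p) ?y = ?x \<ominus>\<^bsub>Y\<^esub> ?y"
      unfolding q_def q0_def
      by (rule Y.two_engel_translation_inverse(1)[OF assms(4) \<gamma>]) (use xy in auto)
    moreover have "(?x \<ominus>\<^bsub>Y\<^esub> ?y) \<oplus>\<^bsub>Y\<^esub> ?y = ?x"
      using xy by (simp add: Y.M.minus_eq Y.M.a_assoc Y.M.l_neg)
    ultimately have "\<phi> (imaginary_addition t P (?k (q p), ?s ?y)) = \<phi> p"
      by (simp add: \<phi>add[OF qc[OF p] xy(2)])
    then show "imaginary_addition t P (?k (q p), ?s ?y) = p"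
      using inj addc[OF qc[OF p] xy(2)] p by blast
  next
    fix a y assume ay: "a \<in> carrier Y" "y \<in> carrier Y"
    let ?b = "a \<oplus>\<^bsub>Y\<^esub> \<gamma> \<odot>\<^bsub>Y\<^esub> bracket Y a y"
    have "?b \<in> carrier Y" using ay \<gamma> by (simp add: Y.bracket_closed)
    then have "(?b \<oplus>\<^bsub>Y\<^esub> y) \<ominus>\<^bsub>Y\<^esub> y = ?b"
      using ay by (simp add: Y.M.minus_eq Y.M.a_assoc Y.M.r_neg)
    then have "q (imaginary_addition t P (?k a, ?s y)) = q0 ?b y"
      by (simp add: q_def \<phi>add[OF ay])
    also have "\<dots> = a"
      unfolding q0_def by (rule Y.two_engel_translation_inverse(2)[OF assms(4) \<gamma> ay])
    finally show "q (imaginary_addition t P (?k a, ?s y)) = a" .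
  next
    show "q \<in> carrier P \<rightarrow> carrier Y" using qc by blast
  qed
qed

end
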